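(* Let $\sigma:\mathrm{Sym}^{++}(3)\to\mathrm{Sym}(3)$, $B\mapsto\sigma(B)=\widehat\sigma(\log B)$, be a continuously differentiable isotropic Cauchy-elastic constitutive law for the Cauchy stress (no stored energy is assumed). Then the following are equivalent: (i) (corotational stability postulate, CSP) for all states and all rates of motion with strain-rate tensor $D\in\mathrm{Sym}(3)\setminus\{0\}$ one has $$\Big\langle \frac{\mathrm{D}^{\mathrm{ZJ}}}{\mathrm{D}t}[\sigma],D\Big\rangle>0;$$ that is, for every continuously differentiable curve $t\mapsto F(t)\in\mathrm{GL}^+(3)$, with $B=FF^T$ and $\sigma=\sigma(B)$ along the curve, this inequality holds at every $t$ for which $D(t)\neq0$; (ii) (TSTS-M$^{++}$) the map $\log B\mapsto\widehat\sigma(\log B)$ is strongly Hilbert-monotone, i.e. $\mathrm{sym}\,\mathrm{D}_{\log B}\widehat\sigma(\log B)\in\mathrm{Sym}^{++}_4(6)$ for all $B\in\mathrm{Sym}^{++}(3)$. Moreover, these equivalent conditions imply (TSTS-M$^{+}$) $$\big\langle\widehat\sigma(\log B_1)-\widehat\sigma(\log B_2),\log B_1-\log B_2\big\rangle>0\qquad\text{for all } B_1\neq B_2\in\mathrm{Sym}^{++}(3).$$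
   Context: $\mathrm{Sym}(3)$ is the space of real symmetric $3\times3$ matrices, $\mathrm{Sym}^{++}(3)$ the set of positive definite ones, $\langle X,Y\rangle=\mathrm{tr}(XY^T)$, and $\mathrm{GL}^+(3)$ is the set of real $3\times 3$ matrices with positive determinant. $\log:\mathrm{Sym}^{++}(3)\to\mathrm{Sym}(3)$ is the principal matrix logarithm (a bijection), so $\widehat\sigma:\mathrm{Sym}(3)\to\mathrm{Sym}(3)$ is defined by $\widehat\sigma(\log B)=\sigma(B)$. Isotropy means $\sigma(QBQ^T)=Q\,\sigma(B)\,Q^T$ for all $Q\in\mathrm{SO}(3)$, $B\in\mathrm{Sym}^{++}(3)$. For a curve $F(t)\in\mathrm{GL}^+(3)$ put $L=\dot F F^{-1}$, $D=\mathrm{sym}\,L=\frac12(L+L^T)$ and $W=\mathrm{skew}\,L=\frac12(L-L^T)$. The Zaremba-Jaumann rate of the stress is $$\frac{\mathrm{D}^{\mathrm{ZJ}}}{\mathrm{D}t}[\sigma]=\frac{\mathrm d}{\mathrm dt}[\sigma]+\sigma W-W\sigma .$$ $\mathrm{D}_{\log B}\widehat\sigma(\log B)$ is the Fréchet derivative of $\widehat\sigma$ at $\log B$, a linear map $\mathrm{Sym}(3)\to\mathrm{Sym}(3)$; $\mathrm{sym}$ of such a linear map is its self-adjoint part with respect to $\langle\cdot,\cdot\rangle$. $\mathrm{Sym}^{++}_4(6)$ is the set of self-adjoint linear maps $\mathbb{C}:\mathrm{Sym}(3)\to\mathrm{Sym}(3)$ with $\langle\mathbb{C}.H,H\rangle>0$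 for all $H\in\mathrm{Sym}(3)\setminus\{0\}$. *)

theory Defs
  imports "HOL-Analysis.Analysis"
begin

type_synonym mat3 = "real^3^3"

section \<open>Symmetric matrices, exponential and logarithm\<close>

text \<open>
  The product \<open>*\<close> on \<open>real^3^3\<close> is componentwise; the matrix product is \<open>**\<close>.
  The library's inner product on \<open>real^3^3\<close> is the Frobenius product:
\<close>

lemma inner_eq_trace:
  fixes X Y :: mat3
  shows "X \<bullet> Y = trace (X ** transpose Y)"
  by (simp add: trace_def matrix_matrix_mult_def transpose_def inner_vec_def)

definition Sym3 :: "mat3 set" where
  "Sym3 = {X. transpose X = X}"

definition Sym3_pp :: "mat3 set" where
  "Sym3_pp = {B \<in> Sym3. \<forall>x. x \<noteq> 0 \<longrightarrow> x \<bullet> (B *v x) > 0}"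

definition GL3_plus :: "mat3 set" where
  "GL3_plus = {F. det F > 0}"

definition mat_exp :: "mat3 \<Rightarrow> mat3" where
  "mat_exp X = (\<Sum>n. (1 / fact n) *\<^sub>R (((**) X ^^ n) (mat 1)))"

text \<open>
  On \<open>Sym3_pp\<close> the principal logarithm is the inverse of the bijection
  \<open>mat_exp : Sym3 \<rightarrow> Sym3_pp\<close>: a symmetric logarithm has real eigenvalues, so it is the
  principal one. Outside \<open>Sym3_pp\<close> the value of \<open>mat_log\<close> is not meaningful.
\<close>

definition mat_log :: "mat3 \<Rightarrow> mat3" where
  "mat_log B = (THE X. X \<in> Sym3 \<and> mat_exp X = B)"

definition mat_sym :: "mat3 \<Rightarrow> mat3" where
  "mat_sym L = (1/2) *\<^sub>R (L + transpose L)"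

definition mat_skew :: "mat3 \<Rightarrow> mat3" where
  "mat_skew L = (1/2) *\<^sub>R (L - transpose L)"

section \<open>Constitutive laws\<close>

text \<open>
  Laws are total functions of which only the values on \<open>Sym3_pp\<close> matter. As \<open>Sym3_pp\<close> is
  open in the subspace \<open>Sym3\<close>, derivatives are taken within these sets; they are determined
  on symmetric directions only, and their values on other directions play no role.
\<close>

definition continuously_differentiable_on ::
    "('a::real_normed_vector \<Rightarrow> 'b::real_normed_vector) \<Rightarrow> 'a set \<Rightarrow> bool" where
  "continuously_differentiable_on f S \<longleftrightarrow>
     (\<exists>f' :: 'a \<Rightarrow> ('a \<Rightarrow>\<^sub>L 'b).
        (\<forall>x\<in>S. (f has_derivative blinfun_apply (f' x)) (at x within S)) \<and>
        continuous_on S f')"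

definition isotropic :: "(mat3 \<Rightarrow> mat3) \<Rightarrow> bool" where
  "isotropic \<sigma> \<longleftrightarrow>
     (\<forall>Q. \<forall>B\<in>Sym3_pp. rotation_matrix Q \<longrightarrow>
        \<sigma> (Q ** B ** transpose Q) = Q ** \<sigma> B ** transpose Q)"

section \<open>Corotational stability postulate\<close>

definition left_cauchy_green :: "(real \<Rightarrow> mat3) \<Rightarrow> real \<Rightarrow> mat3" where
  "left_cauchy_green F t = F t ** transpose (F t)"

definition velocity_gradient :: "(real \<Rightarrow> mat3) \<Rightarrow> real \<Rightarrow> mat3" where
  "velocity_gradient F t = vector_derivative F (at t) ** matrix_inv (F t)"

definition strain_rate :: "(real \<Rightarrow> mat3) \<Rightarrow> real \<Rightarrow> mat3" where
  "strain_rate F t = mat_sym (velocity_gradient F t)"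

definition spin :: "(real \<Rightarrow> mat3) \<Rightarrow> real \<Rightarrow> mat3" where
  "spin F t = mat_skew (velocity_gradient F t)"

definition zaremba_jaumann_rate :: "(mat3 \<Rightarrow> mat3) \<Rightarrow> (real \<Rightarrow> mat3) \<Rightarrow> real \<Rightarrow> mat3" where
  "zaremba_jaumann_rate \<sigma> F t =
     vector_derivative (\<lambda>s. \<sigma> (left_cauchy_green F s)) (at t)
     + \<sigma> (left_cauchy_green F t) ** spin F t - spin F t ** \<sigma> (left_cauchy_green F t)"

definition CSP :: "(mat3 \<Rightarrow> mat3) \<Rightarrow> bool" where
  "CSP \<sigma> \<longleftrightarrow>
     (\<forall>F I. open I \<and> is_interval I \<and> F C1_differentiable_on I \<and> F ` I \<subseteq> GL3_plus \<longrightarrow>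
        (\<forall>t\<in>I. strain_rate F t \<noteq> 0 \<longrightarrow>
           zaremba_jaumann_rate \<sigma> F t \<bullet> strain_rate F t > 0))"

section \<open>Monotonicity in the logarithmic strain\<close>

text \<open>
  A linear map on \<open>Sym3\<close> is represented by a function on all matrices whose values outside
  \<open>Sym3\<close> are ignored. Therefore the adjoint is taken with respect to the subspace \<open>Sym3\<close>;
  the library's \<open>adjoint\<close> would depend on the values outside \<open>Sym3\<close>.
\<close>

definition Sym3_adjoint :: "(mat3 \<Rightarrow> mat3) \<Rightarrow> mat3 \<Rightarrow> mat3" where
  "Sym3_adjoint C K = (THE Z. Z \<in> Sym3 \<and> (\<forall>H\<in>Sym3. C H \<bullet> K = H \<bullet> Z))"

definition Sym3_sym_part :: "(mat3 \<Rightarrow> mat3) \<Rightarrow> mat3 \<Rightarrow> mat3" where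
  "Sym3_sym_part C H = (1/2) *\<^sub>R (C H + Sym3_adjoint C H)"

text \<open>The set written $\mathrm{Sym}^{++}_4(6)$ in the literature.\<close>

definition Sym4_pp :: "(mat3 \<Rightarrow> mat3) set" where
  "Sym4_pp = {C. C ` Sym3 \<subseteq> Sym3
     \<and> (\<forall>H\<in>Sym3. \<forall>K\<in>Sym3. C (H + K) = C H + C K)
     \<and> (\<forall>a. \<forall>H\<in>Sym3. C (a *\<^sub>R H) = a *\<^sub>R C H)
     \<and> (\<forall>H\<in>Sym3. \<forall>K\<in>Sym3. C H \<bullet> K = H \<bullet> C K)
     \<and> (\<forall>H\<in>Sym3 - {0}. C H \<bullet> H > 0)}"

definition TSTS_M_pp :: "(mat3 \<Rightarrow> mat3) \<Rightarrow> bool" where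
  "TSTS_M_pp \<sigma>hat \<longleftrightarrow>
     (\<forall>B\<in>Sym3_pp. \<exists>C. (\<sigma>hat has_derivative C) (at (mat_log B) within Sym3)
        \<and> Sym3_sym_part C \<in> Sym4_pp)"

definition TSTS_M_plus :: "(mat3 \<Rightarrow> mat3) \<Rightarrow> bool" where
  "TSTS_M_plus \<sigma>hat \<longleftrightarrow>
     (\<forall>B1\<in>Sym3_pp. \<forall>B2\<in>Sym3_pp. B1 \<noteq> B2 \<longrightarrow>
        (\<sigma>hat (mat_log B1) - \<sigma>hat (mat_log B2)) \<bullet> (mat_log B1 - mat_log B2) > 0)"

end

(*
  For log B = S the Zaremba-Jaumann rate equals A(D B + B D), where A is the derivative of \<sigma> at B:
  differentiating the isotropy relation along a curve of rotations turns the spin part of the rate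
  of B into the corotational correction. The derivative of the exponential at S and the map
  D \<mapsto> D B + B D are both positive Schur multipliers in an eigenframe of S, so the latter is the
  former composed with N\<^sup>2 for a positive, self-adjoint Schur multiplier N with constant diagonal.
  Isotropy under the half turns about the eigenvectors of S makes the derivative C of the law in
  logarithmic strain commute with N, whence <A(D B + B D), D> = <C(N D), N D>. Since N is bijective
  on symmetric matrices, the two positivity conditions agree. The last claim is the mean value
  theorem along a segment in logarithmic strain.
*)
theory Submission
  imports Defs
begin

section \<open>Matrix algebra\<close>

text \<open>Positivity of \<open>C\<close> and of its composite with N^2 are unrelated in general,
  all the more as \<open>C\<close> need not be self-adjoint without a stored energy. Splitting N^2
  and moving one factor across the inner product repairs this, at the price of needing
  \<open>C\<close> to commute with N. On the diagonal part in the eigenframe the half turns act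
  trivially and say nothing about \<open>C\<close>; commutation there comes from N being scalar on
  it. Neither the derivative of the exponential (diagonal weights e^(s_i)) nor D B + B D (diagonal
  weights 2 e^(s_i)) has that form; their quotient does, with N^2 = 2 on the diagonal. For
  eigenvalues a, b of S with a and b distinct, the weight of N^2 is (a - b) coth((a - b)/2). Half
  turns and divided differences treat repeated eigenvalues like distinct ones, and no eigenvector is
  ever differentiated. The logarithm enters only as the inverse of the exponential, so the chain
  rule is applied to the latter.\<close>

lemma linear_transpose: "linear (transpose :: real^'n^'m \<Rightarrow> real^'m^'n)"
  by (rule linearI) (simp_all add: transpose_def vec_eq_iff)

lemmas transpose_add = linear_add[OF linear_transpose]
  and transpose_diff = linear_diff[OF linear_transpose]

lemma bounded_linear_transpose: "bounded_linear (transpose :: real^'n^'m \<Rightarrow> real^'m^'n)"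
  by (simp add: linear_transpose linear_conv_bounded_linear[symmetric])

lemma bounded_bilinear_matrix_mult:
  "bounded_bilinear ((**) :: real^'n^'m \<Rightarrow> real^'p^'n \<Rightarrow> real^'p^'m)"
  unfolding bilinear_conv_bounded_bilinear[symmetric] bilinear_def
  by (auto intro!: linearI simp: matrix_matrix_mult_def vec_eq_iff sum.distrib
      sum_distrib_left algebra_simps)

lemmas matrix_mult_add_left = bounded_bilinear.add_left[OF bounded_bilinear_matrix_mult]
  and matrix_mult_add_right = bounded_bilinear.add_right[OF bounded_bilinear_matrix_mult]
  and matrix_mult_diff_left = bounded_bilinear.diff_left[OF bounded_bilinear_matrix_mult]
  and matrix_mult_diff_right = bounded_bilinear.diff_right[OF bounded_bilinear_matrix_mult]
  and matrix_mult_minus_left = bounded_bilinear.minus_left[OF bounded_bilinear_matrix_mult]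
  and matrix_mult_minus_right = bounded_bilinear.minus_right[OF bounded_bilinear_matrix_mult]
  and matrix_mult_zero_left = bounded_bilinear.zero_left[OF bounded_bilinear_matrix_mult]
  and matrix_mult_zero_right = bounded_bilinear.zero_right[OF bounded_bilinear_matrix_mult]
  and matrix_mult_scaleR_left = bounded_bilinear.scaleR_left[OF bounded_bilinear_matrix_mult]
  and matrix_mult_scaleR_right = bounded_bilinear.scaleR_right[OF bounded_bilinear_matrix_mult]

lemmas has_vector_derivative_matrix_mult =
  bounded_bilinear.has_vector_derivative[OF bounded_bilinear_matrix_mult]

lemmas has_vector_derivative_transpose =
  bounded_linear.has_vector_derivative[OF bounded_linear_transpose]

lemmas matrix_mult_bilinear_simps =
  matrix_mult_add_left matrix_mult_add_right matrix_mult_diff_left matrix_mult_diff_right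
  matrix_mult_minus_left matrix_mult_minus_right matrix_mult_scaleR_left
  matrix_mult_scaleR_right

lemma inner_matrix_mult_left:
  fixes A :: "real^'n^'m" and X :: "real^'p^'n" and Y :: "real^'p^'m"
  shows "(A ** X) \<bullet> Y = X \<bullet> (transpose A ** Y)"
proof -
  have "(A ** X) \<bullet> Y = (\<Sum>i\<in>UNIV. \<Sum>j\<in>UNIV. \<Sum>k\<in>UNIV. A$i$k * X$k$j * Y$i$j)"
    by (simp add: inner_vec_def matrix_matrix_mult_def sum_distrib_right)
  also have "\<dots> = (\<Sum>j\<in>UNIV. \<Sum>i\<in>UNIV. \<Sum>k\<in>UNIV. A$i$k * X$k$j * Y$i$j)"
    by (rule sum.swap)
  also have "\<dots> = (\<Sum>j\<in>UNIV. \<Sum>k\<in>UNIV. \<Sum>i\<in>UNIV. A$i$k * X$k$j * Y$i$j)"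
    by (rule sum.cong[OF refl sum.swap])
  also have "\<dots> = (\<Sum>k\<in>UNIV. \<Sum>j\<in>UNIV. \<Sum>i\<in>UNIV. A$i$k * X$k$j * Y$i$j)"
    by (rule sum.swap)
  also have "\<dots> = X \<bullet> (transpose A ** Y)"
    by (simp add: inner_vec_def matrix_matrix_mult_def transpose_def sum_distrib_left mult_ac)
  finally show ?thesis .
qed

lemma inner_transpose:
  fixes X Y :: "real^'n^'m"
  shows "transpose X \<bullet> transpose Y = X \<bullet> Y"
  unfolding inner_vec_def transpose_def by (simp, rule sum.swap)

lemma inner_matrix_mult_right:
  fixes A :: "real^'p^'n" and X :: "real^'n^'m" and Y :: "real^'p^'m"
  shows "(X ** A) \<bullet> Y = X \<bullet> (Y ** transpose A)"
proof -
  have "(X ** A) \<bullet> Y = (transpose A ** transpose X) \<bullet> transpose Y"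
    by (metis inner_transpose matrix_transpose_mul)
  also have "\<dots> = transpose X \<bullet> (A ** transpose Y)"
    by (simp add: inner_matrix_mult_left)
  also have "\<dots> = X \<bullet> (Y ** transpose A)"
    by (metis inner_transpose matrix_transpose_mul transpose_transpose)
  finally show ?thesis .
qed

lemma subspace_Sym3: "subspace Sym3"
  by (simp add: subspace_def Sym3_def transpose_add transpose_scalar linear_0[OF linear_transpose])

lemma Sym3_iff: "X \<in> Sym3 \<longleftrightarrow> transpose X = X"
  by (simp add: Sym3_def)

lemma Sym3_conj: "X \<in> Sym3 \<Longrightarrow> A ** X ** transpose A \<in> Sym3"
  by (simp add: Sym3_iff matrix_transpose_mul matrix_mul_assoc)

lemma inner_conj:
  fixes A X Y :: "real^'n^'n"
  shows "(A ** X ** transpose A) \<bullet> Y = X \<bullet> (transpose A ** Y ** A)"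
  by (metis inner_matrix_mult_left inner_matrix_mult_right matrix_mul_assoc transpose_transpose)

lemma orthogonal_matrix_simps:
  assumes "orthogonal_matrix Q"
  shows "transpose Q ** Q = mat 1" "Q ** transpose Q = mat 1"
  using assms by (auto simp: orthogonal_matrix_def)

lemma orthogonal_matrix_cancel:
  fixes Q X :: "real^'n^'n"
  assumes "orthogonal_matrix Q"
  shows "transpose Q ** (Q ** X) = X" "Q ** (transpose Q ** X) = X"
    "X ** Q ** transpose Q = X" "X ** transpose Q ** Q = X"
  using orthogonal_matrix_simps[OF assms]
  by (simp_all add: matrix_mul_assoc) (simp_all flip: matrix_mul_assoc)

section \<open>Rotations\<close>

text \<open>Cayley transform (1 + tK)(1 - tK)^(-1) with K = W/2, whose derivative at 0 is 2K = W. In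
  dimension three it is an explicit quadratic in K with rational coefficients, so that being a
  rotation is a matter of polynomial identities.\<close>

lemma rotation_curve:
  fixes W :: mat3
  assumes "transpose W = - W"
  obtains R :: "real \<Rightarrow> mat3"
  where "\<And>t. rotation_matrix (R t)" "R 0 = mat 1" "(R has_vector_derivative W) (at 0)"
proof -
  define K where "K = (1/2) *\<^sub>R W"
  have Kt: "transpose K = - K" by (simp add: K_def transpose_scalar assms)
  have skew: "K$i$j = - K$j$i" for i j
    using arg_cong[OF Kt, of "\<lambda>X. X$j$i"] by (simp add: transpose_def)
  define a b c where "a = K$3$2" and "b = K$1$3" and "c = K$2$1"
  have K: "K$1$1 = 0" "K$2$2 = 0" "K$3$3 = 0" "K$2$3 = -a" "K$3$1 = -b" "K$1$2 = -c"
    "K$3$2 = a" "K$1$3 = b" "K$2$1 = c"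
    using skew[of 1 1] skew[of 2 2] skew[of 3 3] skew[of 2 3] skew[of 3 1] skew[of 1 2]
    by (simp_all add: a_def b_def c_def)
  define M where "M = K ** K"
  define m where "m = a^2 + b^2 + c^2"
  have M: "M$1$1 = -(b^2)-c^2" "M$2$2 = -(a^2)-c^2" "M$3$3 = -(a^2)-b^2" "M$2$3 = b*c" "M$3$1 = a*c"
    "M$1$2 = a*b" "M$3$2 = b*c" "M$1$3 = a*c" "M$2$1 = a*b"
    by (simp_all add: M_def matrix_matrix_mult_def sum_3 K power2_eq_square)
  \<comment> \<open>Cayley-Hamilton for a skew matrix: K^3 = -m K, with m the squared length of its
    axial vector (a, b, c).\<close>
  have KM: "M ** K = (-m) *\<^sub>R K"
    by (simp add: vec_eq_iff forall_3 matrix_matrix_mult_def sum_3 K M m_def algebra_simps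
        power2_eq_square)
  have MK: "K ** M = (-m) *\<^sub>R K"
    using KM by (simp add: M_def matrix_mul_assoc)
  have MM: "M ** M = (-m) *\<^sub>R M"
    by (metis KM M_def matrix_mul_assoc matrix_mult_scaleR_left)
  have Mt: "transpose M = M"
    by (simp add: M_def matrix_transpose_mul Kt matrix_mult_bilinear_simps)
  define n where "n t = 1 + t^2 * m" for t :: real
  have n: "n t > 0" for t by (auto simp: n_def m_def intro!: add_pos_nonneg)
  \<comment> \<open>Since (1 - tK)^(-1) = 1 + (tK + t^2 K^2)/n, the Cayley transform equals 2 (1 -
    tK)^(-1) - 1 = 1 + g K + h K^2.\<close>
  define g h where "g t = 2 * t / n t" and "h t = 2 * t^2 / n t" for t
  define R where "R t = mat 1 + g t *\<^sub>R K + h t *\<^sub>R M" for t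
  \<comment> \<open>This one identity yields both orthogonality and determinant 1.\<close>
  have gh: "2 * h t - g t^2 - m * h t^2 = 0" for t
  proof -
    have "2 * h t - g t^2 - m * h t^2 = (4 * t^2 / (n t)^2) * (n t - 1 - m * t^2)"
      using n[of t] by (simp add: g_def h_def field_simps power2_eq_square)
    thus ?thesis by (simp add: n_def)
  qed
  have orth: "orthogonal_matrix (R t)" for t
  proof -
    have Rt: "transpose (R t) = mat 1 - g t *\<^sub>R K + h t *\<^sub>R M"
      by (simp add: R_def transpose_add transpose_scalar Kt Mt)
    have "transpose (R t) ** R t = mat 1 + (2 * h t - g t^2 - m * h t^2) *\<^sub>R M"
      unfolding Rt unfolding R_def
      by (simp add: matrix_mult_bilinear_simps M_def[symmetric] KM MK MM)
         (simp add: vec_eq_iff algebra_simps power2_eq_square)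
    thus ?thesis by (simp add: orthogonal_matrix gh)
  qed
  have det: "det (R t) = 1" for t
  proof -
    have "det (R t) = (1 - h t * m)^2 + g t^2 * m"
      unfolding det_3 by (simp add: R_def K M mat_def m_def) (simp add: algebra_simps power2_eq_square)
    also have "\<dots> = 1 - m * (2 * h t - g t^2 - m * h t^2)"
      by (simp add: algebra_simps power2_eq_square)
    finally show ?thesis by (simp add: gh)
  qed
  have n0: "n 0 = 1" by (simp add: n_def)
  have "(n has_real_derivative 0) (at 0)"
    unfolding n_def by (auto intro!: derivative_eq_intros)
  hence "(g has_real_derivative 2) (at 0)" "(h has_real_derivative 0) (at 0)"
    unfolding g_def h_def by (auto intro!: derivative_eq_intros simp: n0)
  hence gh': "(g has_vector_derivative 2) (at 0)" "(h has_vector_derivative 0) (at 0)"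
    by (simp_all add: has_real_derivative_iff_has_vector_derivative)
  have "(R has_vector_derivative (0 + 2 *\<^sub>R K + 0 *\<^sub>R M)) (at 0)"
    unfolding R_def
    by (intro has_vector_derivative_add has_vector_derivative_const
        bounded_linear.has_vector_derivative[OF bounded_linear_scaleR_left] gh')
  hence "(R has_vector_derivative W) (at 0)" by (simp add: K_def)
  moreover have "R 0 = mat 1" by (simp add: R_def g_def h_def)
  ultimately show ?thesis using that orth det by (auto simp: rotation_matrix_def)
qed

lemma conjugation_curve:
  fixes R :: "real \<Rightarrow> mat3"
  assumes "(R has_vector_derivative W) (at 0)" "R 0 = mat 1" "transpose W = - W"
  shows "((\<lambda>t. R t ** X ** transpose (R t)) has_vector_derivative (W ** X - X ** W)) (at 0)"
proof -
  have "((\<lambda>t. R t ** X) has_vector_derivative W ** X) (at 0)"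
    using has_vector_derivative_matrix_mult[OF assms(1) has_vector_derivative_const[of X]]
    by (simp add: matrix_mult_zero_right)
  from has_vector_derivative_matrix_mult[OF this has_vector_derivative_transpose[OF assms(1)]]
  show ?thesis by (simp add: assms(2,3) matrix_mult_minus_right)
qed

section \<open>Spectral theorem\<close>

definition diag :: "real^'n \<Rightarrow> real^'n^'n" where
  "diag s = (\<chi> i j. if i = j then s$i else 0)"

lemma diag_nth: "diag s $ i $ j = (if i = j then s$i else 0)"
  by (simp add: diag_def)

lemma transpose_diag [simp]: "transpose (diag s) = diag s"
  by (simp add: transpose_def diag_def vec_eq_iff)

lemma diag_mult_nth: "(diag s ** X) $ i $ j = s$i * X$i$j"
  by (simp add: matrix_matrix_mult_def diag_def if_distrib if_distribR cong: if_cong)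

lemma mult_diag_nth: "(X ** diag s) $ i $ j = X$i$j * s$j"
  by (simp add: matrix_matrix_mult_def diag_def if_distrib if_distribR cong: if_cong)

lemma diag_mult_diag: "diag s ** diag r = diag (\<chi> i. s$i * r$i)"
  by (simp add: vec_eq_iff diag_mult_nth diag_nth)

lemma det_diag3: "det (diag s :: mat3) = s$1 * s$2 * s$3"
  by (simp add: det_3 diag_nth)

lemma rotation_matrixD:
  assumes "rotation_matrix Q"
  shows "orthogonal_matrix Q" "det Q = 1"
  using assms by (auto simp: rotation_matrix_def)

lemma rotation_matrix_mult:
  fixes A B :: "real^'n^'n"
  shows "rotation_matrix A \<Longrightarrow> rotation_matrix B \<Longrightarrow> rotation_matrix (A ** B)"
  by (simp add: rotation_matrix_def orthogonal_matrix_mul det_mul)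

lemma rotation_matrix_transpose: "rotation_matrix A \<Longrightarrow> rotation_matrix (transpose A)"
  by (auto simp: rotation_matrix_def orthogonal_matrix_def)

text \<open>All rotations have the Frobenius norm of the identity, and the defining equations are
  polynomial in the entries.\<close>

lemma compact_rotation_matrices: "compact {Q :: real^'n^'n. rotation_matrix Q}"
proof (rule compact_eq_bounded_closed[THEN iffD2], rule conjI)
  have "norm Q = sqrt (mat 1 \<bullet> (mat 1 :: real^'n^'n))" if "rotation_matrix Q" for Q :: "real^'n^'n"
  proof -
    have "Q \<bullet> Q = mat 1 \<bullet> (transpose Q ** Q)"
      using inner_matrix_mult_left[of Q "mat 1" Q] by simp
    also have "\<dots> = mat 1 \<bullet> (mat 1 :: real^'n^'n)"
      using that by (simp add: rotation_matrix_def orthogonal_matrix_def)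
    finally show ?thesis by (simp add: norm_eq_sqrt_inner)
  qed
  thus "bounded {Q :: real^'n^'n. rotation_matrix Q}"
    unfolding bounded_iff by auto
  have "{Q :: real^'n^'n. rotation_matrix Q} = {Q. transpose Q ** Q = mat 1} \<inter> {Q. det Q = 1}"
    by (auto simp: rotation_matrix_def orthogonal_matrix)
  moreover have "closed {Q :: real^'n^'n. transpose Q ** Q = mat 1}"
    by (intro closed_Collect_eq continuous_intros
        bounded_bilinear.continuous_on[OF bounded_bilinear_matrix_mult]
        linear_continuous_on bounded_linear_transpose)
  moreover have "closed {Q :: real^'n^'n. det Q = 1}"
    unfolding det_def by (intro closed_Collect_eq continuous_intros)
  ultimately show "closed {Q :: real^'n^'n. rotation_matrix Q}" by auto
qed

text \<open>
  A rotation that maximizes \<open>\<Sum>\<^sub>i i (Q\<^sup>T S Q)\<^sub>i\<^sub>i\<close> diagonalizes \<open>S\<close>: the first variation along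
  infinitesimal rotations is a multiple of the off-diagonal entries, the weights being distinct.
\<close>

lemma Sym3_diagonalization:
  assumes "S \<in> Sym3"
  obtains Q :: mat3 and s where "rotation_matrix Q" "S = Q ** diag s ** transpose Q"
proof -
  define d :: "real^3" where "d = vector [1, 2, 3]"
  define f where "f Q = (transpose Q ** S ** Q) \<bullet> diag d" for Q :: mat3
  have "continuous_on {Q. rotation_matrix Q} f"
    unfolding f_def
    by (intro continuous_intros bounded_bilinear.continuous_on[OF bounded_bilinear_matrix_mult]
        linear_continuous_on bounded_linear_transpose)
  moreover have "rotation_matrix (mat 1 :: mat3)"
    by (simp add: rotation_matrix_def orthogonal_matrix_id)
  ultimately obtain Q where Q: "rotation_matrix Q" "\<And>P. rotation_matrix P \<Longrightarrow> f P \<le> f Q"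
    using continuous_attains_sup[OF compact_rotation_matrices, of f] by auto
  define M where "M = transpose Q ** S ** Q"
  have Msym: "transpose M = M"
    using assms by (simp add: M_def Sym3_iff matrix_transpose_mul matrix_mul_assoc)
  have crit: "(W ** M - M ** W) \<bullet> diag d = 0" if W: "transpose W = - W" for W
  proof -
    obtain R where R: "\<And>t. rotation_matrix (R t)" "R 0 = mat 1" "(R has_vector_derivative W) (at 0)"
      using rotation_curve[OF W] by blast
    \<comment> \<open>Rotating \<open>M\<close> amounts to replacing the maximizer \<open>Q\<close>
      by another rotation, so \<open>t = 0\<close> is a maximum along the curve.\<close>
    have fR: "(R t ** M ** transpose (R t)) \<bullet> diag d = f (Q ** transpose (R t))" for t
      by (simp add: f_def M_def matrix_transpose_mul matrix_mul_assoc)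
    have "((\<lambda>t. (R t ** M ** transpose (R t)) \<bullet> diag d) has_vector_derivative
        (W ** M - M ** W) \<bullet> diag d) (at 0)"
      by (intro bounded_linear.has_vector_derivative[OF bounded_linear_inner_left]
          conjugation_curve R W)
    hence "((\<lambda>t. f (Q ** transpose (R t))) has_real_derivative (W ** M - M ** W) \<bullet> diag d) (at 0)"
      by (simp add: fR has_real_derivative_iff_has_vector_derivative)
    moreover have "f (Q ** transpose (R t)) \<le> f (Q ** transpose (R 0))" for t
      by (simp add: R(1,2) Q rotation_matrix_mult rotation_matrix_transpose)
    ultimately show ?thesis
      by (intro DERIV_local_max[of "\<lambda>t. f (Q ** transpose (R t))" _ 0 1]) auto
  qed
  have sym: "M$i$j = M$j$i" for i j
    using arg_cong[OF Msym, of "\<lambda>X. X$j$i"] by (simp add: transpose_def)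
  \<comment> \<open>For \<open>i\<close> and \<open>j\<close> distinct this generates the rotations
    of the (i, j) coordinate plane; the critical equation then reads 2 (d_i - d_j) M_ij = 0.\<close>
  define G :: "3 \<Rightarrow> 3 \<Rightarrow> mat3"
    where "G i j = (\<chi> k l. if k = i \<and> l = j then 1 else if k = j \<and> l = i then -1 else 0)" for i j
  have Gt: "transpose (G i j) = - G i j" if "i \<noteq> j" for i j
    using that by (auto simp: G_def transpose_def vec_eq_iff)
  have "M$1$2 = 0" "M$1$3 = 0" "M$2$3 = 0"
    using crit[OF Gt[of 1 2]] crit[OF Gt[of 1 3]] crit[OF Gt[of 2 3]]
      sym[of 1 2] sym[of 1 3] sym[of 2 3]
    by (simp_all add: inner_vec_def sum_3 matrix_matrix_mult_def diag_nth d_def G_def)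
  hence "M = diag (\<chi> i. M$i$i)"
    by (simp add: vec_eq_iff forall_3 diag_nth sym[of 2 1] sym[of 3 1] sym[of 3 2])
  moreover have "S = Q ** M ** transpose Q"
    using rotation_matrixD(1)[OF Q(1)]
    by (simp add: M_def orthogonal_matrix_cancel matrix_mul_assoc[symmetric])
       (simp add: orthogonal_matrix_cancel matrix_mul_assoc)
  ultimately show ?thesis using that Q(1) by metis
qed

section \<open>The exponential of matrices and its derivative\<close>

abbreviation mat_pow :: "mat3 \<Rightarrow> nat \<Rightarrow> mat3" where
  "mat_pow X n \<equiv> ((**) X ^^ n) (mat 1)"

text \<open>Product rule for X^(n+1) = X X^n. \<open>H\<close> and \<open>X\<close> need not
  commute, so the derivative is a sum of words X^k H X^(n-1-k) and not n X^(n-1) H.\<close>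

primrec dmat_pow :: "nat \<Rightarrow> mat3 \<Rightarrow> mat3 \<Rightarrow> mat3" where
  "dmat_pow 0 X H = 0"
| "dmat_pow (Suc n) X H = H ** mat_pow X n + X ** dmat_pow n X H"

definition dmat_exp :: "mat3 \<Rightarrow> mat3 \<Rightarrow> mat3" where
  "dmat_exp X H = (\<Sum>n. (1 / fact n) *\<^sub>R dmat_pow n X H)"

lemma has_derivative_mat_pow:
  "((\<lambda>X. mat_pow X n) has_derivative dmat_pow n X) (at X within S)"
proof (induction n)
  case (Suc n)
  show ?case
    using bounded_bilinear.FDERIV[OF bounded_bilinear_matrix_mult has_derivative_ident Suc]
    by (simp add: add.commute)
qed simp

text \<open>The norm is the Frobenius norm, not an operator norm: Cauchy-Schwarz is applied to each
  entry of the product.\<close>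

lemma norm_matrix_mult_le:
  fixes A :: "real^'n^'m" and B :: "real^'p^'n"
  shows "norm (A ** B) \<le> norm A * norm B"
proof -
  have norm2: "(norm X)^2 = (\<Sum>i\<in>UNIV. \<Sum>j\<in>UNIV. (X$i$j)^2)" for X :: "real^'c^'d"
    unfolding power2_norm_eq_inner by (simp add: inner_vec_def power2_eq_square)
  have "(norm (A ** B))^2 \<le> (\<Sum>i\<in>UNIV. \<Sum>j\<in>UNIV. (\<Sum>k\<in>UNIV. (A$i$k)^2) * (\<Sum>k\<in>UNIV. (B$k$j)^2))"
    unfolding norm2 by (intro sum_mono) (simp add: matrix_matrix_mult_def Cauchy_Schwarz_ineq_sum)
  also have "\<dots> = (\<Sum>i\<in>UNIV. \<Sum>k\<in>UNIV. (A$i$k)^2) * (\<Sum>j\<in>UNIV. \<Sum>k\<in>UNIV. (B$k$j)^2)"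
    by (simp add: sum_product)
  also have "\<dots> = (norm A * norm B)^2"
    unfolding power_mult_distrib norm2 by (intro arg_cong2[where f = "(*)"] refl sum.swap)
  finally show ?thesis by (rule power2_le_imp_le) simp
qed

text \<open>The factor \<open>norm (mat 1)\<close> stays because the identity has Frobenius norm
  sqrt 3 rather than 1.\<close>

lemma norm_mat_pow_le:
  assumes "norm X \<le> r"
  shows "norm (mat_pow X n) \<le> norm (mat 1 :: mat3) * r ^ n"
proof (induction n)
  case (Suc n)
  have "norm (mat_pow X (Suc n)) \<le> norm X * norm (mat_pow X n)"
    by (simp add: norm_matrix_mult_le)
  also have "\<dots> \<le> r * (norm (mat 1 :: mat3) * r ^ n)"
    using order_trans[OF norm_ge_zero assms] by (intro mult_mono Suc assms) auto
  finally show ?case by (simp add: mult_ac)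
qed simp

text \<open>There are n words of degree n - 1 in \<open>X\<close>. The condition
  \<open>1 \<le> r\<close> allows \<open>r ^ n\<close> for \<open>r ^ (n - 1)\<close>, and n is at
  most 2^n, so that the majorant is again an exponential series, now in 2r.\<close>

lemma norm_dmat_pow_le:
  assumes "norm X \<le> r" "1 \<le> r"
  shows "norm (dmat_pow n X H) \<le> norm (mat 1 :: mat3) * (2 * r) ^ n * norm H"
proof -
  let ?c = "norm (mat 1 :: mat3)"
  have "norm (dmat_pow n X H) \<le> ?c * real n * r ^ n * norm H"
  proof (induction n)
    case (Suc n)
    have "norm (dmat_pow (Suc n) X H) \<le> norm (mat_pow X n) * norm H + norm X * norm (dmat_pow n X H)"
      using norm_triangle_ineq[of "H ** mat_pow X n" "X ** dmat_pow n X H"]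
        norm_matrix_mult_le[of H "mat_pow X n"] norm_matrix_mult_le[of X "dmat_pow n X H"]
      by (simp add: mult_ac)
    also have "\<dots> \<le> (r * (?c * r ^ n)) * norm H + r * (?c * real n * r ^ n * norm H)"
    proof (intro add_mono mult_mono Suc assms)
      have "?c * r ^ n \<le> r * (?c * r ^ n)" using mult_right_mono[OF assms(2), of "?c * r ^ n"] assms(2) by simp
      with norm_mat_pow_le[OF assms(1), of n] show "norm (mat_pow X n) \<le> r * (?c * r ^ n)" by simp
    qed (use assms in auto)
    finally show ?case by (simp add: algebra_simps)
  qed simp
  also have "\<dots> \<le> ?c * 2 ^ n * r ^ n * norm H"
    using assms(2) by (intro mult_right_mono mult_left_mono) auto
  finally show ?thesis by (simp add: power_mult_distrib mult_ac)
qed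

lemma summable_mat_exp_majorant: "summable (\<lambda>n. norm (mat 1 :: mat3) * r ^ n / fact n)"
proof -
  have "(\<lambda>n. norm (mat 1 :: mat3) * r ^ n / fact n) = (\<lambda>n. norm (mat 1 :: mat3) * (inverse (fact n) * r ^ n))"
    by (simp add: divide_inverse mult_ac)
  thus ?thesis by (simp only: summable_mult summable_exp)
qed

lemma summable_mat_exp: "summable (\<lambda>n. (1 / fact n) *\<^sub>R mat_pow X n)"
  by (rule summable_comparison_test[OF _ summable_mat_exp_majorant[of "norm X"]])
     (auto intro!: divide_right_mono norm_mat_pow_le)

lemma norm_dmat_exp_term_le:
  assumes "norm X \<le> r" "1 \<le> r"
  shows "norm ((1 / fact n) *\<^sub>R dmat_pow n X H)
    \<le> (norm (mat 1 :: mat3) * (2 * r) ^ n / fact n) * norm H"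
  using divide_right_mono[OF norm_dmat_pow_le[OF assms, of n H], of "fact n"] by simp

lemma summable_dmat_exp: "summable (\<lambda>n. (1 / fact n) *\<^sub>R dmat_pow n X H)"
proof (rule summable_comparison_test)
  show "\<exists>N. \<forall>n\<ge>N. norm ((1 / fact n) *\<^sub>R dmat_pow n X H)
      \<le> (norm (mat 1 :: mat3) * (2 * max 1 (norm X)) ^ n / fact n) * norm H"
    by (intro exI allI impI norm_dmat_exp_term_le) auto
qed (intro summable_mult2 summable_mat_exp_majorant)

text \<open>Termwise differentiation on a ball around 0 that contains \<open>X\<close> in its
  interior. The radius \<open>norm X + 1\<close> also meets the condition \<open>1 \<le> r\<close>
  of the majorant.\<close>

lemma has_derivative_mat_exp: "(mat_exp has_derivative dmat_exp X) (at X within S)"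
proof -
  define r where "r = norm X + 1"
  define b where "b n = norm (mat 1 :: mat3) * (2 * r) ^ n / fact n" for n
  have b: "summable b"
    "\<And>X H n. norm X \<le> r \<Longrightarrow> norm ((1 / fact n) *\<^sub>R dmat_pow n X H) \<le> b n * norm H"
    unfolding b_def by (rule summable_mat_exp_majorant, rule norm_dmat_exp_term_le) (auto simp: r_def)
  have "\<exists>g. \<forall>Y\<in>ball 0 r. (\<lambda>n. (1 / fact n) *\<^sub>R mat_pow Y n) sums (g Y) \<and>
      (g has_derivative dmat_exp Y) (at Y within ball 0 r)"
  proof (rule has_derivative_series)
    show "((\<lambda>X. (1 / fact n) *\<^sub>R mat_pow X n) has_derivative (\<lambda>H. (1 / fact n) *\<^sub>R dmat_pow n Y H))
        (at Y within ball 0 r)" for n Y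
      by (intro has_derivative_scaleR_right has_derivative_mat_pow)
    fix e :: real assume "e > 0"
    \<comment> \<open>A tail of the majorant bounds the remainder of the derivative series for all
      points of the ball and all directions at once, which is the uniform convergence
      required.\<close>
    then obtain N where N: "\<And>n. n \<ge> N \<Longrightarrow> norm (\<Sum>i. b (i + n)) < e"
      using suminf_exist_split[OF _ b(1)] by blast
    have "norm ((\<Sum>i<n. (1 / fact i) *\<^sub>R dmat_pow i Y H) - dmat_exp Y H) \<le> e * norm H"
      if "n \<ge> N" "Y \<in> ball 0 r" for n Y H
    proof -
      let ?f = "\<lambda>i. (1 / fact i) *\<^sub>R dmat_pow i Y H"
      have sb: "summable (\<lambda>i. b (i + n))" using b(1) by (simp add: summable_iff_shift)
      have "norm ((\<Sum>i<n. ?f i) - dmat_exp Y H) = norm (\<Sum>i. ?f (i + n))"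
        using suminf_minus_initial_segment[OF summable_dmat_exp[of Y H], of n]
        by (simp add: dmat_exp_def norm_minus_commute)
      also have "\<dots> \<le> (\<Sum>i. b (i + n) * norm H)"
        using b(2) that(2) by (intro norm_suminf_le summable_mult2 sb) auto
      also have "\<dots> = (\<Sum>i. b (i + n)) * norm H" by (rule suminf_mult2[OF sb, symmetric])
      also have "\<dots> \<le> e * norm H"
        using N[OF that(1)] by (intro mult_right_mono) auto
      finally show ?thesis .
    qed
    thus "\<forall>\<^sub>F n in sequentially. \<forall>Y\<in>ball 0 r. \<forall>H.
        norm ((\<Sum>i<n. (1 / fact i) *\<^sub>R dmat_pow i Y H) - dmat_exp Y H) \<le> e * norm H"
      unfolding eventually_sequentially by blast
  next
    show "(\<lambda>n. (1 / fact n) *\<^sub>R mat_pow X n) sums mat_exp X"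
      unfolding mat_exp_def by (rule summable_sums[OF summable_mat_exp])
  qed (auto simp: r_def)
  then obtain g where *: "\<forall>Y\<in>ball 0 r. (\<lambda>n. (1 / fact n) *\<^sub>R mat_pow Y n) sums (g Y) \<and>
      (g has_derivative dmat_exp Y) (at Y within ball 0 r)"
    by (elim exE)
  have X: "X \<in> ball 0 r" by (simp add: r_def)
  have g: "(\<lambda>n. (1 / fact n) *\<^sub>R mat_pow Y n) sums (g Y)" if "Y \<in> ball 0 r" for Y
    using *[rule_format, OF that] by (rule conjunct1)
  have g': "(g has_derivative dmat_exp X) (at X within ball 0 r)"
    using *[rule_format, OF X] by (rule conjunct2)
  have "mat_exp Y = g Y" if "Y \<in> ball 0 r" for Y
    unfolding mat_exp_def using sums_unique[OF g[OF that]] by simp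
  hence "(mat_exp has_derivative dmat_exp X) (at X within ball 0 r)"
    by (intro has_derivative_transform[OF X _ g'])
  hence "(mat_exp has_derivative dmat_exp X) (at X)"
    by (simp add: at_within_open[OF X])
  thus ?thesis by (rule has_derivative_at_withinI)
qed

section \<open>Equivariance of the exponential and its derivative under orthogonal
  conjugation\<close>

lemma mat_pow_conj:
  assumes "orthogonal_matrix Q"
  shows "mat_pow (Q ** X ** transpose Q) n = Q ** mat_pow X n ** transpose Q"
  using assms
  by (induction n) (simp_all add: orthogonal_matrix_simps orthogonal_matrix_cancel
      flip: matrix_mul_assoc)

lemma dmat_pow_conj:
  assumes "orthogonal_matrix Q"
  shows "dmat_pow n (Q ** X ** transpose Q) (Q ** H ** transpose Q)
    = Q ** dmat_pow n X H ** transpose Q"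
proof (induction n)
  case (Suc n)
  show ?case
    unfolding dmat_pow.simps Suc mat_pow_conj[OF assms]
    using assms by (simp add: matrix_mult_add_left matrix_mult_add_right orthogonal_matrix_cancel
        flip: matrix_mul_assoc)
qed (simp add: matrix_mult_zero_left matrix_mult_zero_right)

lemma bounded_linear_conj: "bounded_linear (\<lambda>X :: real^'n^'n. A ** X ** B)"
  by (intro bounded_linear_compose[OF
        bounded_bilinear.bounded_linear_left[OF bounded_bilinear_matrix_mult]
        bounded_bilinear.bounded_linear_right[OF bounded_bilinear_matrix_mult]])

lemma bounded_linear_entry: "bounded_linear (\<lambda>X :: real^'n^'m. X$i$j)"
  by (intro bounded_linear_compose[OF bounded_linear_vec_nth bounded_linear_vec_nth])

lemma mat_exp_conj:
  assumes "orthogonal_matrix Q"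
  shows "mat_exp (Q ** X ** transpose Q) = Q ** mat_exp X ** transpose Q"
  using bounded_linear.suminf[OF bounded_linear_conj[of Q "transpose Q"] summable_mat_exp, of X]
  by (simp add: mat_exp_def mat_pow_conj[OF assms] matrix_mult_scaleR_left matrix_mult_scaleR_right)

lemma dmat_exp_conj:
  assumes "orthogonal_matrix Q"
  shows "dmat_exp (Q ** X ** transpose Q) (Q ** H ** transpose Q) = Q ** dmat_exp X H ** transpose Q"
  using bounded_linear.suminf[OF bounded_linear_conj[of Q "transpose Q"] summable_dmat_exp, of X H]
  by (simp add: dmat_exp_def dmat_pow_conj[OF assms] matrix_mult_scaleR_left matrix_mult_scaleR_right)

section \<open>Diagonal arguments and divided differences\<close>

lemma mat_pow_diag: "mat_pow (diag s) n = diag (\<chi> i. s$i ^ n)"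
  by (induction n) (simp_all add: diag_mult_diag, simp add: vec_eq_iff diag_nth mat_def)

lemma mat_exp_diag: "mat_exp (diag s) = diag (\<chi> i. exp (s$i))"
proof -
  have "mat_exp (diag s) $ i $ j = diag (\<chi> i. exp (s$i)) $ i $ j" for i j
    using bounded_linear.suminf[OF bounded_linear_entry summable_mat_exp, of "diag s" i j]
    by (simp add: mat_exp_def mat_pow_diag diag_nth exp_def divide_inverse)
  thus ?thesis by (simp add: vec_eq_iff)
qed

text \<open>First divided difference of \<open>exp\<close>, extended to the diagonal by its
  limit.\<close>

definition exp_quot :: "real \<Rightarrow> real \<Rightarrow> real" where
  "exp_quot a b = (if a = b then exp a else (exp a - exp b) / (a - b))"

lemma exp_quot_commute: "exp_quot a b = exp_quot b a"
  by (simp add: exp_quot_def divide_simps) (simp add: algebra_simps)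

lemma exp_quot_pos: "exp_quot a b > 0"
  by (auto simp: exp_quot_def zero_less_divide_iff)

text \<open>First divided difference of x^n. For \<open>n = 0\<close> the truncated exponent is
  harmless, as the factor \<open>of_nat n\<close> vanishes.\<close>

definition pow_quot :: "nat \<Rightarrow> real \<Rightarrow> real \<Rightarrow> real" where
  "pow_quot n a b = (if a = b then of_nat n * a ^ (n - 1) else (a ^ n - b ^ n) / (a - b))"

text \<open>Scalar form of the recursion of \<open>dmat_pow\<close>: at a diagonal matrix
  \<open>H ** mat_pow X n\<close> weights an entry by b^n, and left multiplication by
  \<open>X\<close> weights it by a.\<close>

lemma pow_quot_Suc: "pow_quot (Suc n) a b = b ^ n + a * pow_quot n a b"
proof (cases "a = b")
  case True
  thus ?thesis by (cases n) (simp_all add: pow_quot_def algebra_simps)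
next
  case False
  thus ?thesis by (simp add: pow_quot_def divide_simps) (simp add: algebra_simps)
qed

lemma pow_quot_sums: "(\<lambda>n. pow_quot n a b / fact n) sums exp_quot a b"
proof (cases "a = b")
  case True
  \<comment> \<open>The zeroth term is 0, and n a^(n-1)/n! = a^(n-1)/(n-1)! gives the exponential
    series after a shift by one.\<close>
  have "(\<lambda>n. pow_quot (Suc n) a b / fact (Suc n)) sums exp a"
    using exp_converges[of a] True
    by (simp add: pow_quot_def divide_simps del: of_nat_Suc)
  from sums_Suc[OF this] True show ?thesis by (simp add: exp_quot_def pow_quot_def)
next
  case False
  have "(\<lambda>n. (a ^ n /\<^sub>R fact n - b ^ n /\<^sub>R fact n) / (a - b)) sums ((exp a - exp b) / (a - b))"
    by (intro sums_divide sums_diff exp_converges)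
  thus ?thesis using False by (simp add: exp_quot_def pow_quot_def divide_simps mult_ac)
qed

lemma dmat_pow_diag: "dmat_pow n (diag s) H $ i $ j = pow_quot n (s$i) (s$j) * H$i$j"
proof (induction n)
  case (Suc n)
  thus ?case
    by (simp add: mat_pow_diag mult_diag_nth diag_mult_nth pow_quot_Suc algebra_simps)
qed (simp add: pow_quot_def)

text \<open>Daleckii-Krein formula: summing the divided differences of the powers gives those of
  \<open>exp\<close>, also where eigenvalues coincide.\<close>

lemma dmat_exp_diag: "dmat_exp (diag s) H $ i $ j = exp_quot (s$i) (s$j) * H$i$j"
proof -
  have "dmat_exp (diag s) H $ i $ j = (\<Sum>n. pow_quot n (s$i) (s$j) / fact n * H$i$j)"
    using bounded_linear.suminf[OF bounded_linear_entry summable_dmat_exp, of "diag s" H i j]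
    by (simp add: dmat_exp_def dmat_pow_diag)
  thus ?thesis
    using sums_unique[OF sums_mult2[OF pow_quot_sums[of "s$i" "s$j"], of "H$i$j"]] by simp
qed

lemma mat_exp_conj_diag:
  assumes "orthogonal_matrix Q"
  shows "mat_exp (Q ** diag s ** transpose Q) = Q ** diag (\<chi> i. exp (s$i)) ** transpose Q"
  by (simp add: mat_exp_conj[OF assms] mat_exp_diag)

section \<open>The exponential as a bijection from \<open>Sym3\<close> onto
  \<open>Sym3_pp\<close>\<close>

lemma conj_diag_in_Sym3:
  fixes Q :: mat3
  shows "Q ** diag s ** transpose Q \<in> Sym3"
  by (intro Sym3_conj) (simp add: Sym3_iff)

lemma quadratic_form_conj_diag:
  fixes Q :: "real^'n^'n"
  shows "x \<bullet> ((Q ** diag d ** transpose Q) *v x) = (\<Sum>i\<in>UNIV. d$i * ((transpose Q *v x)$i)^2)"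
proof -
  have "x \<bullet> ((Q ** diag d ** transpose Q) *v x) = (x v* Q) \<bullet> (diag d *v (x v* Q))"
    by (simp add: dot_lmul_matrix flip: matrix_vector_mul_assoc)
  thus ?thesis
    by (simp add: inner_vec_def matrix_vector_mult_def[of "diag d"] diag_nth if_distrib if_distribR
        power2_eq_square mult_ac cong: if_cong)
qed

lemma conj_diag_in_Sym3_pp_iff:
  assumes "orthogonal_matrix Q"
  shows "Q ** diag d ** transpose Q \<in> Sym3_pp \<longleftrightarrow> (\<forall>i. d$i > 0)"
proof
  assume pp: "Q ** diag d ** transpose Q \<in> Sym3_pp"
  show "\<forall>i. d$i > 0"
  proof
    fix i
    \<comment> \<open>The i-th column of \<open>Q\<close>, an eigenvector for the eigenvalue
      \<open>d$i\<close>.\<close>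
    let ?x = "Q *v axis i 1"
    have x: "transpose Q *v ?x = axis i 1"
      using orthogonal_matrix_simps[OF assms]
      by (simp only: matrix_vector_mul_assoc matrix_vector_mul_lid)
    have "?x \<noteq> 0"
    proof
      assume "?x = 0"
      hence "axis i (1::real) = 0" using x by (metis matrix_vector_mult_0_right)
      thus False by (simp add: axis_eq_0_iff)
    qed
    hence "?x \<bullet> ((Q ** diag d ** transpose Q) *v ?x) > 0"
      using pp by (simp add: Sym3_pp_def)
    thus "d$i > 0"
      unfolding quadratic_form_conj_diag x by (simp add: axis_def if_distrib if_distribR cong: if_cong)
  qed
next
  assume d: "\<forall>i. d$i > 0"
  have "x \<bullet> ((Q ** diag d ** transpose Q) *v x) > 0" if "x \<noteq> 0" for x
  proof -
    have "Q *v (transpose Q *v x) = x"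
      using orthogonal_matrix_simps[OF assms]
      by (simp only: matrix_vector_mul_assoc matrix_vector_mul_lid)
    hence "transpose Q *v x \<noteq> 0"
      using that by (metis matrix_vector_mult_0_right)
    then obtain i where "(transpose Q *v x)$i \<noteq> 0"
      by (metis vec_eq_iff zero_index)
    thus ?thesis
      unfolding quadratic_form_conj_diag using d
      by (intro sum_pos2[of _ i]) (auto simp: less_imp_le)
  qed
  thus "Q ** diag d ** transpose Q \<in> Sym3_pp"
    by (simp add: Sym3_pp_def conj_diag_in_Sym3)
qed

lemma mat_exp_in_Sym3_pp:
  assumes "S \<in> Sym3"
  shows "mat_exp S \<in> Sym3_pp"
proof -
  obtain Q s where Q: "rotation_matrix Q" "S = Q ** diag s ** transpose Q"
    using Sym3_diagonalization[OF assms] .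
  thus ?thesis
    by (simp add: rotation_matrixD mat_exp_conj_diag conj_diag_in_Sym3_pp_iff)
qed

lemma Sym3_pp_obtain_log:
  assumes "B \<in> Sym3_pp"
  obtains S where "S \<in> Sym3" "mat_exp S = B"
proof -
  obtain Q d where Q: "rotation_matrix Q" "B = Q ** diag d ** transpose Q"
    using Sym3_diagonalization[of B] assms by (auto simp: Sym3_pp_def)
  hence "d$i > 0" for i
    using assms by (simp add: rotation_matrixD conj_diag_in_Sym3_pp_iff)
  hence "mat_exp (Q ** diag (\<chi> i. ln (d$i)) ** transpose Q) = B"
    by (simp add: rotation_matrixD[OF Q(1)] mat_exp_conj_diag Q(2))
  thus ?thesis using that conj_diag_in_Sym3 by blast
qed

text \<open>
  If \<open>P D P\<^sup>T\<close> and \<open>Q D' Q\<^sup>T\<close> have the same exponential, then \<open>R = P\<^sup>T Q\<close> intertwines the exponentials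
  of \<open>D'\<close> and \<open>D\<close>, hence \<open>R\<^sub>i\<^sub>j = 0\<close> whenever \<open>D\<^sub>i\<^sub>i\<close> and \<open>D'\<^sub>j\<^sub>j\<close> differ, and \<open>R\<close> intertwines \<open>D'\<close> and \<open>D\<close>.
\<close>

lemma inj_on_mat_exp: "inj_on mat_exp Sym3"
proof (rule inj_onI)
  fix X Y assume XY: "X \<in> Sym3" "Y \<in> Sym3" "mat_exp X = mat_exp Y"
  obtain P x where P: "rotation_matrix P" "X = P ** diag x ** transpose P"
    using Sym3_diagonalization[OF XY(1)] .
  obtain Q y where Q: "rotation_matrix Q" "Y = Q ** diag y ** transpose Q"
    using Sym3_diagonalization[OF XY(2)] .
  note oP = rotation_matrixD(1)[OF P(1)] and oQ = rotation_matrixD(1)[OF Q(1)]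
  define R where "R = transpose P ** Q"
  let ?e = "\<lambda>s :: real^3. diag (\<chi> i. exp (s$i))"
  have "transpose P ** (P ** ?e x ** transpose P) ** Q
      = transpose P ** (Q ** ?e y ** transpose Q) ** Q"
    using XY(3) by (simp add: P(2) Q(2) mat_exp_conj_diag oP oQ)
  hence "?e x ** R = R ** ?e y"
    by (simp add: R_def orthogonal_matrix_cancel oP oQ matrix_mul_assoc[symmetric]
        orthogonal_matrix_simps)
  from arg_cong[OF this, of "\<lambda>Z. Z$i$j" for i j]
  have "exp (x$i) * R$i$j = R$i$j * exp (y$j)" for i j
    by (simp only: diag_mult_nth mult_diag_nth vec_lambda_beta)
  hence "x$i * R$i$j = R$i$j * y$j" for i j
    by (metis exp_inj_iff mult.commute mult_cancel_right)
  hence DR: "diag x ** R = R ** diag y"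
    by (simp add: vec_eq_iff diag_mult_nth mult_diag_nth)
  have "X = P ** (diag x ** R) ** transpose Q"
    by (simp add: P(2) R_def orthogonal_matrix_cancel oQ matrix_mul_assoc)
  also have "\<dots> = Y"
    unfolding DR by (simp add: Q(2) R_def orthogonal_matrix_simps oP matrix_mul_assoc)
  finally show "X = Y" .
qed

lemma mat_log_mat_exp: "S \<in> Sym3 \<Longrightarrow> mat_log (mat_exp S) = S"
  unfolding mat_log_def using inj_on_mat_exp by (intro the_equality) (auto dest: inj_onD)

lemma mat_log_in_Sym3: "B \<in> Sym3_pp \<Longrightarrow> mat_log B \<in> Sym3"
  and mat_exp_mat_log: "B \<in> Sym3_pp \<Longrightarrow> mat_exp (mat_log B) = B"
  by (metis Sym3_pp_obtain_log mat_log_mat_exp)+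

section \<open>Schur multipliers in an orthonormal frame\<close>

text \<open>Hadamard multiplication by \<open>n\<close>, applied to the components of
  \<open>X\<close> in the frame formed by the columns of \<open>Q\<close>.\<close>

definition schur :: "real^'n^'n \<Rightarrow> ('n \<Rightarrow> 'n \<Rightarrow> real) \<Rightarrow> real^'n^'n \<Rightarrow> real^'n^'n" where
  "schur Q n X = Q ** (\<chi> i j. n i j * (transpose Q ** X ** Q)$i$j) ** transpose Q"

lemma schur_zero: "schur Q n 0 = 0"
  by (simp add: schur_def matrix_mult_zero_left matrix_mult_zero_right flip: zero_vec_def)

lemma schur_in_Sym3:
  assumes "\<And>i j. n i j = n j i" "X \<in> Sym3"
  shows "schur Q n X \<in> Sym3"
proof -
  have "transpose (transpose Q ** X ** Q) = transpose Q ** X ** Q"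
    using assms(2) by (simp add: Sym3_iff matrix_transpose_mul matrix_mul_assoc)
  from arg_cong[OF this, of "\<lambda>Z. Z$j$i" for i j]
  have "(transpose Q ** X ** Q)$i$j = (transpose Q ** X ** Q)$j$i" for i j
    by (simp only: transpose_def vec_lambda_beta)
  thus ?thesis
    unfolding schur_def using assms(1)
    by (intro Sym3_conj) (simp add: Sym3_iff transpose_def vec_eq_iff)
qed

text \<open>Both sides are the same weighted sum of products of frame components. This moves one
  factor N to the other argument of the inner product.\<close>

lemma inner_schur: "schur Q n X \<bullet> Y = X \<bullet> schur Q n Y"
proof -
  have *: "schur Q n X \<bullet> Y
      = (\<Sum>i\<in>UNIV. \<Sum>j\<in>UNIV. n i j * (transpose Q ** X ** Q)$i$j * (transpose Q ** Y ** Q)$i$j)"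
    for X Y
    by (simp add: schur_def inner_conj) (simp add: inner_vec_def)
  show ?thesis
    unfolding * inner_commute[of X] by (simp add: mult_ac)
qed

lemma conj_entries_schur:
  assumes "orthogonal_matrix Q"
  shows "(transpose Q ** schur Q n X ** Q)$i$j = n i j * (transpose Q ** X ** Q)$i$j"
  unfolding schur_def using assms
  by (simp add: orthogonal_matrix_simps orthogonal_matrix_cancel flip: matrix_mul_assoc)

lemma eq_schurI:
  assumes "orthogonal_matrix Q"
    and "\<And>i j. (transpose Q ** Y ** Q)$i$j = n i j * (transpose Q ** X ** Q)$i$j"
  shows "Y = schur Q n X"
proof -
  have "Y = Q ** (transpose Q ** Y ** Q) ** transpose Q"
    using assms(1) by (simp add: orthogonal_matrix_simps orthogonal_matrix_cancel flip: matrix_mul_assoc)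
  also have "transpose Q ** Y ** Q = (\<chi> i j. n i j * (transpose Q ** X ** Q)$i$j)"
    using assms(2) by (simp add: vec_eq_iff)
  finally show ?thesis by (simp add: schur_def)
qed

lemma schur_schur:
  assumes "orthogonal_matrix Q"
  shows "schur Q n (schur Q m X) = schur Q (\<lambda>i j. n i j * m i j) X"
  by (rule eq_schurI[OF assms]) (simp add: conj_entries_schur assms)

lemma schur_one:
  assumes "orthogonal_matrix Q"
  shows "schur Q (\<lambda>_ _. 1) X = X"
  by (rule eq_schurI[OF assms, symmetric]) simp

lemma schur_eq_0_iff:
  assumes "orthogonal_matrix Q" "\<And>i j. n i j \<noteq> 0"
  shows "schur Q n X = 0 \<longleftrightarrow> X = 0"
proof
  assume "schur Q n X = 0"
  hence "schur Q (\<lambda>i j. inverse (n i j)) (schur Q n X) = 0" by (simp add: schur_zero)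
  thus "X = 0" by (simp add: schur_schur assms schur_one)
qed (simp add: schur_zero)

lemma dmat_exp_eq_schur:
  assumes "orthogonal_matrix Q"
  shows "dmat_exp (Q ** diag s ** transpose Q) H = schur Q (\<lambda>i j. exp_quot (s$i) (s$j)) H"
proof -
  have "H = Q ** (transpose Q ** H ** Q) ** transpose Q"
    using assms by (simp add: orthogonal_matrix_simps orthogonal_matrix_cancel flip: matrix_mul_assoc)
  hence "dmat_exp (Q ** diag s ** transpose Q) H
      = Q ** dmat_exp (diag s) (transpose Q ** H ** Q) ** transpose Q"
    by (metis dmat_exp_conj[OF assms])
  also have "dmat_exp (diag s) (transpose Q ** H ** Q)
      = (\<chi> i j. exp_quot (s$i) (s$j) * (transpose Q ** H ** Q)$i$j)"
    by (simp add: vec_eq_iff dmat_exp_diag)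
  finally show ?thesis by (simp add: schur_def)
qed

lemma anticommutator_eq_schur:
  assumes "orthogonal_matrix Q" "B = Q ** diag b ** transpose Q"
  shows "H ** B + B ** H = schur Q (\<lambda>i j. b$i + b$j) H"
proof (rule eq_schurI[OF assms(1)])
  fix i j
  let ?H = "transpose Q ** H ** Q"
  have "transpose Q ** (H ** B + B ** H) ** Q = ?H ** diag b + diag b ** ?H"
    unfolding assms(2) using assms(1)
    by (simp add: matrix_mult_add_left matrix_mult_add_right orthogonal_matrix_simps
        orthogonal_matrix_cancel flip: matrix_mul_assoc)
  thus "(transpose Q ** (H ** B + B ** H) ** Q)$i$j = (b$i + b$j) * ?H$i$j"
    by (simp add: diag_mult_nth mult_diag_nth algebra_simps)
qed

text \<open>For a rotation \<open>Q\<close>, the rotation by pi about its k-th column. Two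
  eigenvalues -1 keep the determinant positive, so isotropy under SO(3) applies to it, as it would
  not to a reflection.\<close>

definition half_turn :: "mat3 \<Rightarrow> 3 \<Rightarrow> mat3" where
  "half_turn Q k = Q ** diag (\<chi> i. if i = k then 1 else -1) ** transpose Q"

lemma transpose_half_turn: "transpose (half_turn Q k) = half_turn Q k"
  by (simp add: half_turn_def matrix_transpose_mul matrix_mul_assoc)

lemma half_turn_sq:
  assumes "orthogonal_matrix Q"
  shows "half_turn Q k ** half_turn Q k = mat 1"
proof -
  have 1: "diag (\<chi> i. if i = k then 1 else -1) ** diag (\<chi> i. if i = k then 1 else -1) = (mat 1 :: mat3)"
    by (simp add: diag_mult_diag) (simp add: vec_eq_iff diag_nth mat_def)
  have "half_turn Q k ** half_turn Q k
     = Q ** (diag (\<chi> i. if i = k then 1 else -1) ** diag (\<chi> i. if i = k then 1 else -1)) ** transpose Q"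
    unfolding half_turn_def using assms by (simp add: orthogonal_matrix_cancel flip: matrix_mul_assoc)
  thus ?thesis using assms by (simp add: 1 orthogonal_matrix_simps)
qed

lemma rotation_half_turn:
  assumes "rotation_matrix Q"
  shows "rotation_matrix (half_turn Q k)"
proof -
  have "det (half_turn Q k) = 1"
    using rotation_matrixD(2)[OF assms] exhaust_3[of k]
    by (auto simp: half_turn_def det_mul det_diag3)
  thus ?thesis
    using half_turn_sq[OF rotation_matrixD(1)[OF assms]]
    by (simp add: rotation_matrix_def orthogonal_matrix transpose_half_turn)
qed

lemma half_turn_conj_diag:
  assumes "orthogonal_matrix Q"
  shows "half_turn Q k ** (Q ** diag s ** transpose Q) ** half_turn Q k = Q ** diag s ** transpose Q"
proof -
  let ?r = "diag (\<chi> i. if i = k then 1 else -1) :: mat3"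
  have 1: "?r ** diag s ** ?r = diag s"
    by (simp add: diag_mult_diag) (simp add: vec_eq_iff diag_nth)
  have "half_turn Q k ** (Q ** diag s ** transpose Q) ** half_turn Q k
     = Q ** (?r ** diag s ** ?r) ** transpose Q"
    unfolding half_turn_def using assms by (simp add: orthogonal_matrix_cancel flip: matrix_mul_assoc)
  thus ?thesis by (simp add: 1)
qed

text \<open>
  The half turns about the axes of the frame form, with the identity, a Klein four-group. Its
  characters on symmetric matrices separate the diagonal part and the three off-diagonal entries.
\<close>

lemma schur_eq_half_turn_combination:
  assumes "orthogonal_matrix Q" "\<And>i j. n i j = n j i" "\<And>i. n i i = d"
  obtains c0 c where
    "\<And>X. schur Q n X = c0 *\<^sub>R X + (\<Sum>k\<in>UNIV. c k *\<^sub>R (half_turn Q k ** X ** half_turn Q k))"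
proof
  \<comment> \<open>Conjugation by the k-th half turn keeps the entry (i, j) if i = j or k differs
    from both, and flips its sign otherwise. The coefficients solve the resulting 4 by 4 system for
    d, n12, n13, n23; its matrix has entries 1 and -1 and orthogonal rows, hence the inverse is the
    transpose divided by 4.\<close>
  define c0 where "c0 = (d + n 1 2 + n 1 3 + n 2 3) / 4"
  define c :: "3 \<Rightarrow> real" where
    "c k = (if k = 1 then d - n 1 2 - n 1 3 + n 2 3 else if k = 2 then d - n 1 2 + n 1 3 - n 2 3
            else d + n 1 2 - n 1 3 - n 2 3) / 4" for k
  fix X
  let ?X = "transpose Q ** X ** Q"
  let ?r = "\<lambda>k. diag (\<chi> i. if i = k then 1 else -1) :: mat3"
  let ?Y = "c0 *\<^sub>R X + (\<Sum>k\<in>UNIV. c k *\<^sub>R (half_turn Q k ** X ** half_turn Q k))"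
  have "transpose Q ** (half_turn Q k ** X ** half_turn Q k) ** Q = ?r k ** ?X ** ?r k" for k
    unfolding half_turn_def using assms(1)
    by (simp add: orthogonal_matrix_simps orthogonal_matrix_cancel flip: matrix_mul_assoc)
  hence Y: "transpose Q ** ?Y ** Q = c0 *\<^sub>R ?X + (\<Sum>k\<in>UNIV. c k *\<^sub>R (?r k ** ?X ** ?r k))"
    by (simp add: sum_3 matrix_mult_bilinear_simps)
  have nn: "n 2 1 = n 1 2" "n 3 1 = n 1 3" "n 3 2 = n 2 3" "n 1 1 = d" "n 2 2 = d" "n 3 3 = d"
    by (rule assms(2), rule assms(2), rule assms(2), rule assms(3), rule assms(3), rule assms(3))
  have "(transpose Q ** ?Y ** Q)$i$j = n i j * ?X$i$j" for i j
    unfolding Y using exhaust_3[of i] exhaust_3[of j]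
    by (elim disjE; simp add: sum_3 diag_mult_nth mult_diag_nth c0_def c_def nn; simp add: field_simps)
  thus "schur Q n X = ?Y"
    by (intro eq_schurI[OF assms(1), symmetric])
qed

section \<open>Derivatives within a subset along curves\<close>

text \<open>\<open>Sym3\<close> and \<open>Sym3_pp\<close> have empty interior among all matrices,
  so only derivatives within them are available. A curve that stays in the set during an open set of
  times still yields a full derivative in time.\<close>

lemma has_vector_derivative_compose_curve:
  assumes "(g has_vector_derivative v) (at t)" "open I" "t \<in> I" "\<And>s. s \<in> I \<Longrightarrow> g s \<in> V"
    and "(f has_derivative C) (at (g t) within V)"
  shows "((\<lambda>s. f (g s)) has_vector_derivative C v) (at t)"
proof -
  have "(g has_derivative (\<lambda>h. h *\<^sub>R v)) (at t within I)"
    using assms(1) by (simp add: has_vector_derivative_def has_derivative_at_withinI)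
  moreover have "(f has_derivative C) (at (g t) within g ` I)"
    using assms(4) by (intro has_derivative_subset[OF assms(5)]) auto
  ultimately have "((\<lambda>s. f (g s)) has_derivative (\<lambda>h. C (h *\<^sub>R v))) (at t within I)"
    by (rule has_derivative_in_compose)
  thus ?thesis
    unfolding has_vector_derivative_def at_within_open[OF assms(3,2)]
      linear_scale[OF has_derivative_linear[OF assms(5)]] .
qed

lemma has_vector_derivative_along_line:
  assumes "subspace V" "x \<in> V" "h \<in> V" "(f has_derivative C) (at (x + t *\<^sub>R h) within V)"
  shows "((\<lambda>s. f (x + s *\<^sub>R h)) has_vector_derivative C h) (at t)"
proof (rule has_vector_derivative_compose_curve[where g = "\<lambda>s. x + s *\<^sub>R h" and I = UNIV and V = V])
  show "((\<lambda>s. x + s *\<^sub>R h) has_vector_derivative h) (at t)"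
    by (auto intro!: derivative_eq_intros)
  show "x + s *\<^sub>R h \<in> V" for s
    using assms(1-3) by (simp add: subspace_add subspace_scale)
qed (use assms(4) in auto)

text \<open>Derivatives within a subspace may differ on transversal directions; lines inside the
  subspace determine the rest.\<close>

lemma has_derivative_unique_on_subspace:
  assumes "subspace V" "x \<in> V" "h \<in> V"
    and "(f has_derivative C) (at x within V)" "(f has_derivative C') (at x within V)"
  shows "C h = C' h"
  using has_vector_derivative_along_line[OF assms(1-3), of f _ 0] assms(4,5)
  by (intro vector_derivative_unique_at[of "\<lambda>s. f (x + s *\<^sub>R h)" _ 0]) auto

text \<open>Along a line in \<open>Sym3\<close> the values of \<open>f\<close> equal their
  transposes, hence so does the derivative.\<close>

lemma derivative_Sym3_valued:
  assumes "\<And>S. S \<in> Sym3 \<Longrightarrow> f S \<in> Sym3" "(f has_derivative C) (at S within Sym3)"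
    and "S \<in> Sym3" "H \<in> Sym3"
  shows "C H \<in> Sym3"
proof -
  have "((\<lambda>s. f (S + s *\<^sub>R H)) has_vector_derivative C H) (at 0)"
    using assms by (intro has_vector_derivative_along_line[OF subspace_Sym3]) auto
  moreover from has_vector_derivative_transpose[OF this]
  have "((\<lambda>s. f (S + s *\<^sub>R H)) has_vector_derivative transpose (C H)) (at 0)"
    using assms(1)[unfolded Sym3_iff] assms(3,4)
    by (simp add: subspace_add[OF subspace_Sym3] subspace_scale[OF subspace_Sym3] Sym3_iff
        transpose_add transpose_scalar)
  ultimately show ?thesis
    unfolding Sym3_iff by (rule vector_derivative_unique_at[rotated])
qed

lemma has_vector_derivative_conj:
  fixes f :: "real \<Rightarrow> real^'n^'n"
  assumes "(f has_vector_derivative v) F"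
  shows "((\<lambda>t. A ** f t ** B) has_vector_derivative (A ** v ** B)) F"
  by (rule bounded_linear.has_vector_derivative[OF bounded_linear_conj assms])

text \<open>Equivariance is differentiated at a fixed point \<open>S\<close> of the conjugation, so
  the same derivative \<open>C\<close> appears on both sides.\<close>

lemma derivative_commutes_with_conj:
  assumes iso: "\<And>X. X \<in> Sym3 \<Longrightarrow> f (U ** X ** transpose U) = U ** f X ** transpose U"
    and S: "S \<in> Sym3" "U ** S ** transpose U = S"
    and C: "(f has_derivative C) (at S within Sym3)" and X: "X \<in> Sym3"
  shows "C (U ** X ** transpose U) = U ** C X ** transpose U"
proof (rule vector_derivative_unique_at)
  show "((\<lambda>t. f (S + t *\<^sub>R (U ** X ** transpose U))) has_vector_derivative
      C (U ** X ** transpose U)) (at 0)"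
    using S(1) X C by (intro has_vector_derivative_along_line[OF subspace_Sym3] Sym3_conj) auto
  have "S + t *\<^sub>R X \<in> Sym3" for t
    using S(1) X by (simp add: subspace_add subspace_scale subspace_Sym3)
  hence "f (S + t *\<^sub>R (U ** X ** transpose U)) = U ** f (S + t *\<^sub>R X) ** transpose U" for t
    using iso[of "S + t *\<^sub>R X"] by (simp add: matrix_mult_bilinear_simps S(2))
  moreover have "((\<lambda>t. U ** f (S + t *\<^sub>R X) ** transpose U) has_vector_derivative
      U ** C X ** transpose U) (at 0)"
    using S(1) X C
    by (intro has_vector_derivative_conj has_vector_derivative_along_line[OF subspace_Sym3]) auto
  ultimately show "((\<lambda>t. f (S + t *\<^sub>R (U ** X ** transpose U))) has_vector_derivative
      U ** C X ** transpose U) (at 0)" by simp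
qed

lemma derivative_commutes_with_schur:
  assumes iso: "\<And>U X. rotation_matrix U \<Longrightarrow> X \<in> Sym3
      \<Longrightarrow> f (U ** X ** transpose U) = U ** f X ** transpose U"
    and Q: "rotation_matrix Q" and S: "S = Q ** diag s ** transpose Q"
    and C: "(f has_derivative C) (at S within Sym3)" and X: "X \<in> Sym3"
    and n: "\<And>i j. n i j = n j i" "\<And>i. n i i = d"
  shows "C (schur Q n X) = schur Q n (C X)"
proof -
  obtain c0 c where c: "\<And>X. schur Q n X
      = c0 *\<^sub>R X + (\<Sum>k\<in>UNIV. c k *\<^sub>R (half_turn Q k ** X ** half_turn Q k))"
    by (rule schur_eq_half_turn_combination[of Q n d, OF rotation_matrixD(1)[OF Q] n]) (rule that)
  interpret C: linear C by (rule has_derivative_linear[OF C])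
  have "C (half_turn Q k ** X ** half_turn Q k) = half_turn Q k ** C X ** half_turn Q k" for k
    using derivative_commutes_with_conj[OF iso[OF rotation_half_turn[OF Q]] _ _ C X, of k]
      half_turn_conj_diag[OF rotation_matrixD(1)[OF Q]]
    by (simp add: transpose_half_turn S conj_diag_in_Sym3)
  thus ?thesis
    unfolding c by (simp add: C.add C.sum C.scale)
qed

section \<open>Positivity in terms of stretching and of logarithmic strain\<close>

lemma positive_stretching_iff_positive_log:
  assumes iso: "\<And>U X. rotation_matrix U \<Longrightarrow> X \<in> Sym3
      \<Longrightarrow> f (U ** X ** transpose U) = U ** f X ** transpose U"
    and S: "S \<in> Sym3" and C: "(f has_derivative C) (at S within Sym3)"
    and A: "\<And>H. H \<in> Sym3 \<Longrightarrow> C H = A (dmat_exp S H)"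
  shows "(\<forall>D\<in>Sym3 - {0}. A (D ** mat_exp S + mat_exp S ** D) \<bullet> D > 0)
    \<longleftrightarrow> (\<forall>H\<in>Sym3 - {0}. C H \<bullet> H > 0)"
proof -
  obtain Q s where Q: "rotation_matrix Q" and SQ: "S = Q ** diag s ** transpose Q"
    using Sym3_diagonalization[OF S] .
  note o = rotation_matrixD(1)[OF Q]
  \<comment> \<open>The weights of N; the square root lets one factor act on each side of the inner
    product.\<close>
  define n where "n i j = sqrt ((exp (s$i) + exp (s$j)) / exp_quot (s$i) (s$j))" for i j
  have n_sym: "n i j = n j i" for i j
    by (simp add: n_def exp_quot_commute[of "s$i"] add.commute)
  \<comment> \<open>The factors exp(s_i) cancel in the quotient; this constancy is what the
    commutation with \<open>C\<close> rests on.\<close>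
  have n_diag: "n i i = sqrt 2" for i by (simp add: n_def exp_quot_def)
  have n_pos: "n i j > 0" for i j
    by (simp add: n_def exp_quot_pos add_pos_pos)
  have n_sq: "exp_quot (s$i) (s$j) * (n i j * n i j) = exp (s$i) + exp (s$j)" for i j
    using exp_quot_pos[of "s$i" "s$j"] by (simp add: n_def less_imp_le add_pos_pos)
  have key: "A (D ** mat_exp S + mat_exp S ** D) \<bullet> D = C (schur Q n D) \<bullet> schur Q n D"
    if D: "D \<in> Sym3" for D
  proof -
    have nD: "schur Q n D \<in> Sym3" by (rule schur_in_Sym3[OF n_sym D])
    have "D ** mat_exp S + mat_exp S ** D = schur Q (\<lambda>i j. exp (s$i) + exp (s$j)) D"
      unfolding SQ mat_exp_conj_diag[OF o] by (subst anticommutator_eq_schur[OF o refl]) simp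
    also have "\<dots> = dmat_exp S (schur Q n (schur Q n D))"
      by (simp add: SQ dmat_exp_eq_schur[OF o] schur_schur[OF o] n_sq)
    finally have "A (D ** mat_exp S + mat_exp S ** D) = C (schur Q n (schur Q n D))"
      by (simp add: A schur_in_Sym3[OF n_sym nD])
    also have "\<dots> = schur Q n (C (schur Q n D))"
      by (rule derivative_commutes_with_schur[OF iso Q SQ C nD n_sym n_diag])
    finally show ?thesis by (simp add: inner_schur)
  qed
  have nz: "n i j \<noteq> 0" for i j using n_pos[of i j] by simp
  show ?thesis
  proof (intro iffI ballI)
    fix H assume *: "\<forall>D\<in>Sym3 - {0}. A (D ** mat_exp S + mat_exp S ** D) \<bullet> D > 0"
      and H: "H \<in> Sym3 - {0}"
    \<comment> \<open>N is inverted entrywise, so every \<open>H\<close> arises from some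
      stretching.\<close>
    define D where "D = schur Q (\<lambda>i j. inverse (n i j)) H"
    have H_eq: "schur Q n D = H"
      by (simp add: D_def schur_schur[OF o] nz schur_one[OF o])
    have "D \<in> Sym3" unfolding D_def using H n_sym by (intro schur_in_Sym3) auto
    moreover have "D \<noteq> 0" using H H_eq by (auto simp: schur_zero)
    ultimately show "C H \<bullet> H > 0" using bspec[OF *, of D] key[of D] by (simp add: H_eq)
  next
    fix D assume *: "\<forall>H\<in>Sym3 - {0}. C H \<bullet> H > 0" and D: "D \<in> Sym3 - {0}"
    hence "schur Q n D \<in> Sym3 - {0}"
      using schur_in_Sym3[OF n_sym] schur_eq_0_iff[OF o nz] by auto
    thus "A (D ** mat_exp S + mat_exp S ** D) \<bullet> D > 0" using * key[of D] D by auto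
  qed
qed

section \<open>Isotropy and the Zaremba-Jaumann rate\<close>

lemma matrix_inv_left: "invertible A \<Longrightarrow> matrix_inv A ** A = mat 1"
  and matrix_inv_right: "invertible A \<Longrightarrow> A ** matrix_inv A = mat 1"
  unfolding invertible_def matrix_inv_def by (metis (mono_tags, lifting) someI_ex)+

lemma GL3_plus_invertible: "F \<in> GL3_plus \<Longrightarrow> invertible F"
  by (simp add: GL3_plus_def invertible_det_nz)

lemma matrix_mult_transpose_in_Sym3_pp:
  fixes F :: mat3
  assumes "invertible F"
  shows "F ** transpose F \<in> Sym3_pp"
proof -
  have "x \<bullet> ((F ** transpose F) *v x) > 0" if "x \<noteq> 0" for x
  proof -
    have "matrix_inv (transpose F) *v (transpose F *v x) = x"
      using assms by (simp only: matrix_vector_mul_assoc matrix_inv_left[OF transpose_invertible]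
          matrix_vector_mul_lid)
    hence "x v* F \<noteq> 0"
      using that by (metis matrix_vector_mult_0_right transpose_matrix_vector)
    moreover have "x \<bullet> ((F ** transpose F) *v x) = (x v* F) \<bullet> (x v* F)"
      by (simp add: dot_lmul_matrix flip: matrix_vector_mul_assoc)
    ultimately show ?thesis by simp
  qed
  thus ?thesis by (simp add: Sym3_pp_def Sym3_iff matrix_transpose_mul)
qed

text \<open>Square roots of the eigenvalues in a rotated frame give a factor of positive
  determinant, hence an admissible deformation gradient for the state \<open>B\<close>.\<close>

lemma Sym3_pp_decomposition:
  assumes "B \<in> Sym3_pp"
  obtains P where "P \<in> GL3_plus" "B = P ** transpose P"
proof -
  obtain Q d where Q: "rotation_matrix Q" "B = Q ** diag d ** transpose Q"
    using Sym3_diagonalization[of B] assms by (auto simp: Sym3_pp_def)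
  hence d: "d$i > 0" for i
    using assms by (simp add: rotation_matrixD conj_diag_in_Sym3_pp_iff)
  let ?r = "diag (\<chi> i. sqrt (d$i)) :: mat3"
  have "?r ** ?r = diag d"
    using d by (simp add: diag_mult_diag less_imp_le)
  hence "B = Q ** (?r ** ?r) ** transpose Q" by (simp only: Q(2))
  hence "B = (Q ** ?r) ** transpose (Q ** ?r)"
    by (simp only: matrix_transpose_mul transpose_diag matrix_mul_assoc)
  moreover have "Q ** ?r \<in> GL3_plus"
    using d rotation_matrixD(2)[OF Q(1)] by (simp add: GL3_plus_def det_mul det_diag3)
  ultimately show ?thesis using that by blast
qed

lemma rotation_invertible:
  fixes R :: mat3
  assumes "rotation_matrix R"
  shows "invertible R"
  using rotation_matrixD(2)[OF assms] by (simp add: invertible_det_nz)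

lemma Sym3_pp_rotation:
  assumes "rotation_matrix R" "B \<in> Sym3_pp"
  shows "R ** B ** transpose R \<in> Sym3_pp"
proof -
  obtain P where P: "P \<in> GL3_plus" "B = P ** transpose P"
    using Sym3_pp_decomposition[OF assms(2)] .
  have "invertible (R ** P)"
    using assms(1) P(1) by (simp add: invertible_mult rotation_invertible GL3_plus_invertible)
  from matrix_mult_transpose_in_Sym3_pp[OF this] show ?thesis
    by (simp add: P(2) matrix_transpose_mul matrix_mul_assoc)
qed

text \<open>The directions \<open>W ** B - B ** W\<close> are tangent to the orbit of
  \<open>B\<close> under rotations, where isotropy prescribes the law.\<close>

lemma isotropic_derivative_spin:
  assumes "isotropic \<sigma>" "B \<in> Sym3_pp" "transpose W = - W"
    and "(\<sigma> has_derivative A) (at B within Sym3_pp)"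
  shows "A (W ** B - B ** W) = W ** \<sigma> B - \<sigma> B ** W"
proof -
  obtain R where R: "\<And>t. rotation_matrix (R t)" "R 0 = mat 1" "(R has_vector_derivative W) (at 0)"
    by (rule rotation_curve[OF assms(3)]) (rule that)
  have "(\<sigma> has_derivative A) (at (R 0 ** B ** transpose (R 0)) within Sym3_pp)"
    using assms(4) by (simp add: R(2))
  from has_vector_derivative_compose_curve[OF conjugation_curve[OF R(3,2) assms(3)] open_UNIV UNIV_I
      Sym3_pp_rotation[OF R(1) assms(2)] this]
  have "((\<lambda>t. \<sigma> (R t ** B ** transpose (R t))) has_vector_derivative A (W ** B - B ** W)) (at 0)" .
  moreover have "\<sigma> (R t ** B ** transpose (R t)) = R t ** \<sigma> B ** transpose (R t)" for t
    using assms(1,2) R(1) by (simp add: isotropic_def)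
  ultimately show ?thesis
    using vector_derivative_unique_at[OF _ conjugation_curve[OF R(3,2) assms(3), of "\<sigma> B"]]
    by simp
qed

lemma mat_sym_plus_mat_skew: "mat_sym L + mat_skew L = L"
  by (simp add: mat_sym_def mat_skew_def flip: scaleR_add_right)

lemma mat_sym_minus_mat_skew: "mat_sym L - mat_skew L = transpose L"
  by (simp add: mat_sym_def mat_skew_def flip: scaleR_diff_right)

lemma mat_sym_in_Sym3: "mat_sym L \<in> Sym3"
  by (simp add: mat_sym_def Sym3_iff transpose_scalar transpose_add add.commute)

lemma transpose_mat_skew: "transpose (mat_skew L) = - mat_skew L"
  by (simp add: mat_skew_def transpose_scalar transpose_diff flip: scaleR_minus_right)

lemma zaremba_jaumann_rate_eq:
  assumes "isotropic \<sigma>"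
    and F: "(F has_vector_derivative F') (at t)" "open I" "t \<in> I" "F ` I \<subseteq> GL3_plus"
    and A: "(\<sigma> has_derivative A) (at (left_cauchy_green F t) within Sym3_pp)"
  shows "zaremba_jaumann_rate \<sigma> F t
    = A (strain_rate F t ** left_cauchy_green F t + left_cauchy_green F t ** strain_rate F t)"
proof -
  let ?B = "left_cauchy_green F t" and ?D = "strain_rate F t" and ?W = "spin F t"
  define L where "L = velocity_gradient F t"
  have "L ** F t = F'"
    using GL3_plus_invertible[of "F t"] F(3,4) vector_derivative_at[OF F(1)]
    by (auto simp: L_def velocity_gradient_def matrix_inv_left simp flip: matrix_mul_assoc)
  hence B': "(left_cauchy_green F has_vector_derivative ?B ** transpose L + L ** ?B) (at t)"
    using has_vector_derivative_matrix_mult[OF F(1) has_vector_derivative_transpose[OF F(1)]]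
    by (auto simp: left_cauchy_green_def[abs_def] matrix_transpose_mul matrix_mul_assoc)
  have pp: "left_cauchy_green F s \<in> Sym3_pp" if "s \<in> I" for s
    unfolding left_cauchy_green_def
    using F(4) that by (intro matrix_mult_transpose_in_Sym3_pp GL3_plus_invertible) auto
  interpret A: linear A by (rule has_derivative_linear[OF A])
  have D: "L = ?D + ?W" "transpose L = ?D - ?W"
    by (simp_all add: L_def strain_rate_def spin_def mat_sym_plus_mat_skew mat_sym_minus_mat_skew)
  \<comment> \<open>The rate L B + B L^T of \<open>B\<close> splits into a stretching part and a
    part tangent to the rotation orbit.\<close>
  have split: "?B ** transpose L + L ** ?B = (?D ** ?B + ?B ** ?D) + (?W ** ?B - ?B ** ?W)"
    unfolding D(2) unfolding D(1) by (simp add: matrix_mult_bilinear_simps)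
  have "vector_derivative (\<lambda>s. \<sigma> (left_cauchy_green F s)) (at t) = A (?B ** transpose L + L ** ?B)"
    by (rule vector_derivative_at[OF has_vector_derivative_compose_curve[OF B' F(2,3) pp A]])
  \<comment> \<open>The contribution of the spin is exactly opposite to the corotational terms of
    the rate.\<close>
  also have "\<dots> = A (?D ** ?B + ?B ** ?D) + (?W ** \<sigma> ?B - \<sigma> ?B ** ?W)"
    unfolding split A.add
    using isotropic_derivative_spin[OF assms(1) pp[OF F(3)] _ A, of ?W]
    by (simp add: spin_def transpose_mat_skew)
  finally show ?thesis by (simp add: zaremba_jaumann_rate_def)
qed

lemma motion_with_stretching:
  assumes "B \<in> Sym3_pp" "D \<in> Sym3"
  obtains F I where "open I" "is_interval I" "F C1_differentiable_on I" "F ` I \<subseteq> GL3_plus" "0 \<in> I"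
    "left_cauchy_green F 0 = B" "strain_rate F 0 = D"
proof -
  obtain P where P: "P \<in> GL3_plus" "B = P ** transpose P"
    using Sym3_pp_decomposition[OF assms(1)] .
  \<comment> \<open>The motion (1 + tD)P has velocity gradient \<open>D\<close> at time 0, symmetric
    and thus without spin. It is invertible only near 0, whence the small time interval.\<close>
  define F where "F t = P + t *\<^sub>R (D ** P)" for t :: real
  have F': "(F has_vector_derivative D ** P) (at t)" for t
    unfolding F_def by (auto intro!: derivative_eq_intros)
  have "open {t. 0 < det (F t)}"
    unfolding F_def det_def by (intro open_Collect_less continuous_intros)
  moreover have "0 \<in> {t. 0 < det (F t)}" using P(1) by (simp add: F_def GL3_plus_def)
  ultimately obtain e where e: "e > 0" "ball 0 e \<subseteq> {t. 0 < det (F t)}"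
    by (rule openE)
  show ?thesis
  proof (rule that[of "ball 0 e" F])
    show "F C1_differentiable_on ball 0 e"
      unfolding C1_differentiable_on_def using F' by (intro exI[of _ "\<lambda>_. D ** P"]) auto
    show "F ` ball 0 e \<subseteq> GL3_plus" using e(2) by (auto simp: GL3_plus_def)
    show "left_cauchy_green F 0 = B" by (simp add: left_cauchy_green_def F_def P(2))
    have "velocity_gradient F 0 = D"
      using vector_derivative_at[OF F'[of 0]] GL3_plus_invertible[OF P(1)]
      by (simp add: velocity_gradient_def F_def matrix_inv_right flip: matrix_mul_assoc)
    thus "strain_rate F 0 = D"
      using assms(2) by (simp add: strain_rate_def mat_sym_def Sym3_iff flip: scaleR_2)
  qed (use e(1) in \<open>auto simp: is_interval_ball_real\<close>)
qed

text \<open>The rate depends on the motion only through the current \<open>B\<close> and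
  \<open>D\<close>, and every such pair is realized; the postulate becomes pointwise.\<close>

lemma CSP_iff_positive_stretching:
  assumes "isotropic \<sigma>" "\<And>B. B \<in> Sym3_pp \<Longrightarrow> (\<sigma> has_derivative A B) (at B within Sym3_pp)"
  shows "CSP \<sigma> \<longleftrightarrow> (\<forall>B\<in>Sym3_pp. \<forall>D\<in>Sym3 - {0}. A B (D ** B + B ** D) \<bullet> D > 0)"
proof (intro iffI ballI)
  fix B D assume csp: "CSP \<sigma>" and B: "B \<in> Sym3_pp" and D: "D \<in> Sym3 - {0}"
  obtain F I where F: "open I" "is_interval I" "F C1_differentiable_on I" "F ` I \<subseteq> GL3_plus" "0 \<in> I"
    "left_cauchy_green F 0 = B" "strain_rate F 0 = D"
    by (rule motion_with_stretching[OF B, of D]) (use D in \<open>auto intro: that\<close>)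
  obtain F' where F': "(F has_vector_derivative F') (at 0)"
    using F(3,5) by (auto simp: C1_differentiable_on_def)
  have "zaremba_jaumann_rate \<sigma> F 0 \<bullet> D > 0"
    using csp[unfolded CSP_def, rule_format, of I F 0] F D by auto
  thus "A B (D ** B + B ** D) \<bullet> D > 0"
    using zaremba_jaumann_rate_eq[OF assms(1) F' F(1,5,4), of "A B"] assms(2)[OF B]
    by (simp add: F(6,7))
next
  assume pos: "\<forall>B\<in>Sym3_pp. \<forall>D\<in>Sym3 - {0}. A B (D ** B + B ** D) \<bullet> D > 0"
  show "CSP \<sigma>"
    unfolding CSP_def
  proof (intro allI impI ballI)
    fix F I t
    assume F: "open I \<and> is_interval I \<and> F C1_differentiable_on I \<and> F ` I \<subseteq> GL3_plus"
      and t: "t \<in> I" and D: "strain_rate F t \<noteq> 0"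
    obtain F' where F': "(F has_vector_derivative F') (at t)"
      using F t by (auto simp: C1_differentiable_on_def)
    have B: "left_cauchy_green F t \<in> Sym3_pp"
      unfolding left_cauchy_green_def
      using F t by (intro matrix_mult_transpose_in_Sym3_pp GL3_plus_invertible) auto
    have "strain_rate F t \<in> Sym3 - {0}"
      using D mat_sym_in_Sym3 by (simp add: strain_rate_def)
    with pos B show "zaremba_jaumann_rate \<sigma> F t \<bullet> strain_rate F t > 0"
      using zaremba_jaumann_rate_eq[OF assms(1) F' _ t _ assms(2)[OF B]] F by simp
  qed
qed

section \<open>Strong monotonicity\<close>

text \<open>A symmetric matrix is orthogonal to the skew part of any matrix.\<close>

lemma inner_mat_sym: "H \<in> Sym3 \<Longrightarrow> H \<bullet> mat_sym Y = H \<bullet> Y"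
  using inner_transpose[of H Y]
  by (simp add: Sym3_iff mat_sym_def inner_add_right)

text \<open>The adjoint on the subspace is the orthogonal projection to \<open>Sym3\<close> of the
  adjoint on all matrices.\<close>

lemma Sym3_adjoint_eq:
  assumes "linear C"
  shows "Sym3_adjoint C K = mat_sym (adjoint C K)"
  unfolding Sym3_adjoint_def
proof (rule the_equality)
  show *: "mat_sym (adjoint C K) \<in> Sym3 \<and> (\<forall>H\<in>Sym3. C H \<bullet> K = H \<bullet> mat_sym (adjoint C K))"
    by (simp add: mat_sym_in_Sym3 inner_mat_sym adjoint_works[OF assms])
  fix Z assume Z: "Z \<in> Sym3 \<and> (\<forall>H\<in>Sym3. C H \<bullet> K = H \<bullet> Z)"
  let ?H = "Z - mat_sym (adjoint C K)"
  have "?H \<in> Sym3" using Z * by (simp add: subspace_diff[OF subspace_Sym3])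
  hence "?H \<bullet> Z = ?H \<bullet> mat_sym (adjoint C K)" using Z * by metis
  hence "?H \<bullet> ?H = 0" by (simp add: inner_diff_right)
  thus "Z = mat_sym (adjoint C K)" by simp
qed

text \<open>The quadratic form of a linear map sees only its self-adjoint part; the remaining
  conditions of \<open>Sym4_pp\<close> hold by construction.\<close>

lemma Sym3_sym_part_in_Sym4_pp_iff:
  assumes C: "linear C" "C ` Sym3 \<subseteq> Sym3"
  shows "Sym3_sym_part C \<in> Sym4_pp \<longleftrightarrow> (\<forall>H\<in>Sym3 - {0}. C H \<bullet> H > 0)"
proof -
  have eq: "Sym3_sym_part C H = (1/2) *\<^sub>R (C H + mat_sym (adjoint C H))" for H
    by (simp add: Sym3_sym_part_def Sym3_adjoint_eq[OF C(1)])
  have lin: "linear (Sym3_sym_part C)"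
    using C(1) adjoint_linear[OF C(1)]
    by (intro linearI; simp add: eq mat_sym_def linear_add linear_scale transpose_add transpose_scalar
        scaleR_add_right)
  have inner: "Sym3_sym_part C H \<bullet> K = (1/2) * (C H \<bullet> K + H \<bullet> C K)" if "K \<in> Sym3" for H K
    using inner_mat_sym[OF that, of "adjoint C H"] adjoint_works[OF C(1), of K H]
    by (simp add: eq inner_add_left inner_add_right inner_commute)
  have "Sym3_sym_part C ` Sym3 \<subseteq> Sym3"
    using C(2) by (auto simp: eq mat_sym_in_Sym3 subspace_add subspace_scale subspace_Sym3)
  moreover have "Sym3_sym_part C H \<bullet> H = C H \<bullet> H" if "H \<in> Sym3" for H
    using inner[OF that, of H] by (simp add: inner_commute)
  moreover have "Sym3_sym_part C H \<bullet> K = H \<bullet> Sym3_sym_part C K" if "H \<in> Sym3" "K \<in> Sym3" for H K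
    using inner[OF that(2), of H] inner[OF that(1), of K] by (simp add: inner_commute add.commute)
  ultimately show ?thesis
    unfolding Sym4_pp_def mem_Collect_eq
    by (simp add: linear_add[OF lin] linear_scale[OF lin])
qed

text \<open>All derivatives within \<open>Sym3\<close> agree on symmetric directions, so the
  existential quantifier can be evaluated at the given \<open>C S\<close>; \<open>mat_log\<close>
  reaches all of \<open>Sym3\<close>.\<close>

lemma TSTS_M_pp_iff_positive_log:
  assumes C: "\<And>S. S \<in> Sym3 \<Longrightarrow> (f has_derivative C S) (at S within Sym3)"
    and f: "\<And>S. S \<in> Sym3 \<Longrightarrow> f S \<in> Sym3"
  shows "TSTS_M_pp f \<longleftrightarrow> (\<forall>S\<in>Sym3. \<forall>H\<in>Sym3 - {0}. C S H \<bullet> H > 0)"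
proof -
  have eq: "(\<exists>C'. (f has_derivative C') (at S within Sym3) \<and> Sym3_sym_part C' \<in> Sym4_pp)
      \<longleftrightarrow> (\<forall>H\<in>Sym3 - {0}. C S H \<bullet> H > 0)" if S: "S \<in> Sym3" for S
  proof -
    have "Sym3_sym_part C' \<in> Sym4_pp \<longleftrightarrow> (\<forall>H\<in>Sym3 - {0}. C S H \<bullet> H > 0)"
      if C': "(f has_derivative C') (at S within Sym3)" for C'
    proof -
      have "C' ` Sym3 \<subseteq> Sym3" using derivative_Sym3_valued[OF f C' S] by auto
      moreover have "C' H = C S H" if "H \<in> Sym3" for H
        by (rule has_derivative_unique_on_subspace[OF subspace_Sym3 S that C' C[OF S]])
      ultimately show ?thesis
        by (simp add: Sym3_sym_part_in_Sym4_pp_iff[OF has_derivative_linear[OF C']])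
    qed
    thus ?thesis using C[OF S] by blast
  qed
  have surj: "Sym3 = mat_log ` Sym3_pp"
    using mat_log_in_Sym3 mat_log_mat_exp mat_exp_in_Sym3_pp by (force simp: image_iff)
  have "TSTS_M_pp f \<longleftrightarrow> (\<forall>S\<in>Sym3. \<exists>C'. (f has_derivative C') (at S within Sym3)
      \<and> Sym3_sym_part C' \<in> Sym4_pp)"
    unfolding TSTS_M_pp_def surj by (simp only: ball_simps)
  also have "\<dots> \<longleftrightarrow> (\<forall>S\<in>Sym3. \<forall>H\<in>Sym3 - {0}. C S H \<bullet> H > 0)"
    by (intro ball_cong refl eq)
  finally show ?thesis .
qed

lemma TSTS_M_plus_if_positive_log:
  assumes C: "\<And>S. S \<in> Sym3 \<Longrightarrow> (f has_derivative C S) (at S within Sym3)"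
    and pos: "\<And>S H. S \<in> Sym3 \<Longrightarrow> H \<in> Sym3 - {0} \<Longrightarrow> C S H \<bullet> H > 0"
  shows "TSTS_M_plus f"
  unfolding TSTS_M_plus_def
proof (intro ballI impI)
  fix B1 B2 assume B: "B1 \<in> Sym3_pp" "B2 \<in> Sym3_pp" "B1 \<noteq> B2"
  let ?S1 = "mat_log B1" and ?S2 = "mat_log B2"
  define H where "H = ?S1 - ?S2"
  have S: "?S1 \<in> Sym3" "?S2 \<in> Sym3" using B mat_log_in_Sym3 by auto
  have "H \<noteq> 0" using B mat_exp_mat_log unfolding H_def by (metis eq_iff_diff_eq_0)
  hence H: "H \<in> Sym3 - {0}" using S by (simp add: H_def subspace_diff[OF subspace_Sym3])
  have St: "?S2 + t *\<^sub>R H \<in> Sym3" for t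
    using S(2) H by (simp add: subspace_add subspace_scale subspace_Sym3)
  \<comment> \<open>The monotonicity gap is the increment of this function over [0, 1]; its
    derivative is the quadratic form of \<open>C\<close> at \<open>H\<close>.\<close>
  let ?g = "\<lambda>t. f (?S2 + t *\<^sub>R H) \<bullet> H"
  have "(?g has_real_derivative C (?S2 + t *\<^sub>R H) H \<bullet> H) (at t)" for t
    unfolding has_real_derivative_iff_has_vector_derivative
    by (intro bounded_linear.has_vector_derivative[OF bounded_linear_inner_left]
        has_vector_derivative_along_line[OF subspace_Sym3 S(2) _ C[OF St]]) (use H in auto)
  hence "?g 0 < ?g 1"
    using pos[OF St H] by (intro DERIV_pos_imp_increasing[of 0 1 ?g]) auto
  moreover have "?S2 + H = ?S1" by (simp add: H_def)
  ultimately show "(f ?S1 - f ?S2) \<bullet> (?S1 - ?S2) > 0"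
    by (simp add: H_def[symmetric] inner_diff_left)
qed

theorem mainTheorem1:
  fixes \<sigma> \<sigma>hat :: "real^3^3 \<Rightarrow> real^3^3"
  assumes "\<sigma> ` Sym3_pp \<subseteq> Sym3"
    and "continuously_differentiable_on \<sigma> Sym3_pp"
    and "isotropic \<sigma>"
    and "\<forall>B\<in>Sym3_pp. \<sigma>hat (mat_log B) = \<sigma> B"
  shows "(CSP \<sigma> \<longleftrightarrow> TSTS_M_pp \<sigma>hat) \<and> (CSP \<sigma> \<longrightarrow> TSTS_M_plus \<sigma>hat)"
proof -
  obtain \<sigma>' where \<sigma>': "\<And>B. B \<in> Sym3_pp \<Longrightarrow> (\<sigma> has_derivative blinfun_apply (\<sigma>' B)) (at B within Sym3_pp)"
    using assms(2) by (auto simp: continuously_differentiable_on_def)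
  define A where "A B = blinfun_apply (\<sigma>' B)" for B
  have A: "(\<sigma> has_derivative A B) (at B within Sym3_pp)" if "B \<in> Sym3_pp" for B
    unfolding A_def by (rule \<sigma>'[OF that])
  \<comment> \<open>Chain rule for the law composed with the exponential.\<close>
  define C where "C S H = A (mat_exp S) (dmat_exp S H)" for S H
  have \<sigma>hat: "\<sigma>hat S = \<sigma> (mat_exp S)" if "S \<in> Sym3" for S
    using assms(4) mat_exp_in_Sym3_pp[OF that] mat_log_mat_exp[OF that] by metis
  have C: "(\<sigma>hat has_derivative C S) (at S within Sym3)" if S: "S \<in> Sym3" for S
  proof -
    have "(\<sigma> has_derivative A (mat_exp S)) (at (mat_exp S) within mat_exp ` Sym3)"
      using mat_exp_in_Sym3_pp
      by (intro has_derivative_subset[OF A[OF mat_exp_in_Sym3_pp[OF S]]]) auto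
    from has_derivative_in_compose[OF has_derivative_mat_exp this]
    have "((\<lambda>X. \<sigma> (mat_exp X)) has_derivative C S) (at S within Sym3)"
      by (simp only: C_def[abs_def])
    with S \<sigma>hat show ?thesis by (rule has_derivative_transform)
  qed
  \<comment> \<open>The exponential commutes with conjugation by rotations, so isotropy passes to
    the law in logarithmic strain.\<close>
  have iso: "\<sigma>hat (U ** X ** transpose U) = U ** \<sigma>hat X ** transpose U"
    if "rotation_matrix U" "X \<in> Sym3" for U X
    using assms(3) that mat_exp_in_Sym3_pp[OF that(2)] mat_exp_conj[OF rotation_matrixD(1)[OF that(1)]]
    by (simp add: \<sigma>hat Sym3_conj isotropic_def)
  have surj: "Sym3_pp = mat_exp ` Sym3"
    using mat_exp_in_Sym3_pp mat_exp_mat_log mat_log_in_Sym3 by (force simp: image_iff)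
  have "CSP \<sigma> \<longleftrightarrow> (\<forall>B\<in>Sym3_pp. \<forall>D\<in>Sym3 - {0}. A B (D ** B + B ** D) \<bullet> D > 0)"
    by (rule CSP_iff_positive_stretching[OF assms(3)]) (rule A)
  also have "\<dots> \<longleftrightarrow> (\<forall>S\<in>Sym3. \<forall>D\<in>Sym3 - {0}.
      A (mat_exp S) (D ** mat_exp S + mat_exp S ** D) \<bullet> D > 0)"
    unfolding surj by (simp only: ball_simps)
  also have "\<dots> \<longleftrightarrow> (\<forall>S\<in>Sym3. \<forall>H\<in>Sym3 - {0}. C S H \<bullet> H > 0)"
    by (intro ball_cong refl positive_stretching_iff_positive_log[OF iso _ C]) (simp_all add: C_def)
  finally have csp: "CSP \<sigma> \<longleftrightarrow> (\<forall>S\<in>Sym3. \<forall>H\<in>Sym3 - {0}. C S H \<bullet> H > 0)" .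
  have "\<sigma>hat S \<in> Sym3" if "S \<in> Sym3" for S
    using assms(1) mat_exp_in_Sym3_pp[OF that] by (auto simp: \<sigma>hat[OF that])
  hence "CSP \<sigma> \<longleftrightarrow> TSTS_M_pp \<sigma>hat"
    unfolding csp by (simp add: TSTS_M_pp_iff_positive_log[OF C])
  moreover have "CSP \<sigma> \<longrightarrow> TSTS_M_plus \<sigma>hat"
    unfolding csp using TSTS_M_plus_if_positive_log[OF C] by blast
  ultimately show ?thesis ..
qed

end
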